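(* $H_1(\widehat{\Gamma}_{X_6};\mathbb{Z})\cong\mathbb{Z}\times\mathbb{Z}/2$, and the generators are the images of $\alpha_1$ and $\beta_1$ (that is, the images of $\alpha_1$ and $\beta_1$ generate $H_1(\widehat{\Gamma}_{X_6};\mathbb{Z})$).
   Context: For a group $G$, $H_1(G;\mathbb{Z})=G/[G,G]$ is the abelianization. Matrices and mutations. Let $I$ be a finite set (no frozen vertices here) and $\varepsilon=(\varepsilon_{ij})_{i,j\in I}$ an integer skew-symmetric matrix (exchange matrix), identified with the quiver with vertex set $I$ and $\varepsilon_{ij}$ arrows $i\to j$ whenever $\varepsilon_{ij}>0$. For $k\in I$, the mutation $\mu_k(\varepsilon)=\varepsilon'$ is $\varepsilon'_{ij}=-\varepsilon_{ij}$ if $k\in\{i,j\}$, and $\varepsilon'_{ij}=\varepsilon_{ij}+\frac12(|\varepsilon_{ik}|\varepsilon_{kj}+\varepsilon_{ik}|\varepsilon_{kj}|)$ otherwise. A permutation $\sigma$ of $I$ acts by $\sigma(\varepsilon)_{ij}=\varepsilon_{\sigma^{-1}(i),\sigma^{-1}(j)}$. A mutation sequence is a finite composition of mutations and permutations, applied from right to left; it is a mutation loop at $\varepsilon$ if it sends $\varepsilon$ to $\varepsilon$. Saturated cluster modular group. $\widehat{\Gamma}_\varepsilon$ is the group (under composition) of mutation loops with initial exchange matrix $\varepsilon$, modulo the equivalence relation generated by: (1) $\mu_k\mu_k=1$; (2) $\sigma\mu_k\sigma^{-1}=\mu_{\sigma(k)}$ for permutations $\sigma$; (3) the standard relations, applicable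 at any stage of a sequence to the current matrix $\varepsilon'$: $\mu_i\mu_j=\mu_j\mu_i$ if $\varepsilon'_{ij}=0$, and $\mu_i\mu_j\mu_i\mu_j\mu_i=(i\ j)$ if $\varepsilon'_{ij}=\pm1$. Permutations compose as usual (right to left). Type $X_6$. $I=\{1,\dots,6\}$, and the quiver $X_6$ has one arrow $1\to2$, two arrows $2\to3$, one arrow $3\to1$, one arrow $1\to4$, two arrows $4\to5$, one arrow $5\to1$, one arrow $1\to6$, and no other arrows. $\widehat{\Gamma}_{X_6}$ is the saturated cluster modular group based at this quiver. The elements are $\alpha_1=(2\ 3)\mu_2$ and $\beta_1=(1\ 5\ 2\ 6\ 3\ 4)\mu_4\mu_2\mu_4\mu_3\mu_1$ (cycles $a\mapsto b\mapsto\cdots$). *)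

theory Defs
  imports
    "HOL-Algebra.Generated_Groups"
    "HOL-Algebra.Elementary_Groups"
    "HOL-Combinatorics.Cycles"
begin

section \<open>Exchange matrices and mutations\<close>

text \<open>
  A matrix indexed by a finite set \<open>I\<close> is a function on the ambient type vanishing outside
  \<open>I \<times> I\<close>, so that equality of matrices is equality of functions.
\<close>

type_synonym 'a matrix = "'a \<Rightarrow> 'a \<Rightarrow> int"

definition exchange_matrix :: "'a set \<Rightarrow> 'a matrix \<Rightarrow> bool" where
  "exchange_matrix I \<epsilon> \<longleftrightarrow>
     finite I \<and> (\<forall>i j. \<epsilon> i j = - \<epsilon> j i) \<and> (\<forall>i j. i \<notin> I \<or> j \<notin> I \<longrightarrow> \<epsilon> i j = 0)"

text \<open>The numerator is \<open>0\<close> or \<open>\<plusminus> 2 * \<epsilon> i k * \<epsilon> k j\<close>, so the integer division is exact.\<close>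

definition mutate :: "'a \<Rightarrow> 'a matrix \<Rightarrow> 'a matrix" where
  "mutate k \<epsilon> = (\<lambda>i j. if i = k \<or> j = k then - \<epsilon> i j
     else \<epsilon> i j + (\<bar>\<epsilon> i k\<bar> * \<epsilon> k j + \<epsilon> i k * \<bar>\<epsilon> k j\<bar>) div 2)"

definition permute_matrix :: "('a \<Rightarrow> 'a) \<Rightarrow> 'a matrix \<Rightarrow> 'a matrix" where
  "permute_matrix \<sigma> \<epsilon> = (\<lambda>i j. \<epsilon> (inv_into UNIV \<sigma> i) (inv_into UNIV \<sigma> j))"

section \<open>Mutation sequences\<close>

datatype 'a letter = Mut 'a | Perm "'a \<Rightarrow> 'a"

text \<open>
  A word is written as in the mathematical notation, so its last letter is applied first, and the
  composition of two sequences is concatenation of words.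
\<close>

type_synonym 'a word = "'a letter list"

definition words :: "'a set \<Rightarrow> 'a word set" where
  "words I = lists (Mut ` I \<union> Perm ` {\<sigma>. \<sigma> permutes I})"

fun apply_letter :: "'a letter \<Rightarrow> 'a matrix \<Rightarrow> 'a matrix" where
  "apply_letter (Mut k) \<epsilon> = mutate k \<epsilon>"
| "apply_letter (Perm \<sigma>) \<epsilon> = permute_matrix \<sigma> \<epsilon>"

definition apply_word :: "'a word \<Rightarrow> 'a matrix \<Rightarrow> 'a matrix" where
  "apply_word w \<epsilon> = foldr apply_letter w \<epsilon>"

definition mutation_loops :: "'a set \<Rightarrow> 'a matrix \<Rightarrow> 'a word set" where
  "mutation_loops I \<epsilon> = {w \<in> words I. apply_word w \<epsilon> = \<epsilon>}"

section \<open>The saturated cluster modular group\<close>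

text \<open>
  \<open>elementary_relation I \<epsilon>\<close> lists the relations that may be used when the current matrix is \<open>\<epsilon>\<close>.
\<close>

inductive elementary_relation :: "'a set \<Rightarrow> 'a matrix \<Rightarrow> 'a word \<Rightarrow> 'a word \<Rightarrow> bool"
  for I :: "'a set" and \<epsilon> :: "'a matrix" where
  perm_id: "elementary_relation I \<epsilon> [Perm id] []"
| perm_comp: "\<lbrakk>\<sigma> permutes I; \<tau> permutes I\<rbrakk>
    \<Longrightarrow> elementary_relation I \<epsilon> [Perm \<sigma>, Perm \<tau>] [Perm (\<sigma> \<circ> \<tau>)]"
| involution: "k \<in> I \<Longrightarrow> elementary_relation I \<epsilon> [Mut k, Mut k] []"
| conjugation: "\<lbrakk>\<sigma> permutes I; k \<in> I\<rbrakk>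
    \<Longrightarrow> elementary_relation I \<epsilon> [Perm \<sigma>, Mut k, Perm (inv_into UNIV \<sigma>)] [Mut (\<sigma> k)]"
| square: "\<lbrakk>i \<in> I; j \<in> I; \<epsilon> i j = 0\<rbrakk>
    \<Longrightarrow> elementary_relation I \<epsilon> [Mut i, Mut j] [Mut j, Mut i]"
| pentagon: "\<lbrakk>i \<in> I; j \<in> I; \<epsilon> i j = 1 \<or> \<epsilon> i j = - 1\<rbrakk>
    \<Longrightarrow> elementary_relation I \<epsilon> [Mut i, Mut j, Mut i, Mut j, Mut i] [Perm (transpose i j)]"

text \<open>The subword being replaced acts on the matrix obtained after applying \<open>v\<close>.\<close>

inductive elementary_move :: "'a set \<Rightarrow> 'a matrix \<Rightarrow> 'a word \<Rightarrow> 'a word \<Rightarrow> bool"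
  for I :: "'a set" and \<epsilon> :: "'a matrix" where
  "\<lbrakk>u \<in> words I; v \<in> words I; elementary_relation I (apply_word v \<epsilon>) x y\<rbrakk>
    \<Longrightarrow> elementary_move I \<epsilon> (u @ x @ v) (u @ y @ v)"

definition loop_equiv :: "'a set \<Rightarrow> 'a matrix \<Rightarrow> ('a word \<times> 'a word) set" where
  "loop_equiv I \<epsilon> = {(w, w'). w \<in> mutation_loops I \<epsilon> \<and> w' \<in> mutation_loops I \<epsilon> \<and>
     equivclp (\<lambda>x y. x \<in> mutation_loops I \<epsilon> \<and> y \<in> mutation_loops I \<epsilon> \<and>
       elementary_move I \<epsilon> x y) w w'}"

definition loop_class :: "'a set \<Rightarrow> 'a matrix \<Rightarrow> 'a word \<Rightarrow> 'a word set" where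
  "loop_class I \<epsilon> w = loop_equiv I \<epsilon> `` {w}"

definition saturated_modular_group :: "'a set \<Rightarrow> 'a matrix \<Rightarrow> 'a word set monoid" where
  "saturated_modular_group I \<epsilon> =
     \<lparr>carrier = mutation_loops I \<epsilon> // loop_equiv I \<epsilon>,
      monoid.mult = (\<lambda>A B. \<Union>a\<in>A. \<Union>b\<in>B. loop_class I \<epsilon> (a @ b)),
      one = loop_class I \<epsilon> []\<rparr>"

section \<open>Abelianization\<close>

definition abelianization :: "('g, 'b) monoid_scheme \<Rightarrow> 'g set monoid" where
  "abelianization G = G Mod (derived G (carrier G))"

definition ab_class :: "('g, 'b) monoid_scheme \<Rightarrow> 'g \<Rightarrow> 'g set" where
  "ab_class G g = derived G (carrier G) #>\<^bsub>G\<^esub> g"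

section \<open>Type \<open>X\<^sub>6\<close>\<close>

definition X6_vertices :: "nat set" where
  "X6_vertices = {1..6}"

definition X6_arrows :: "nat \<Rightarrow> nat \<Rightarrow> nat" where
  "X6_arrows i j =
     (if (i, j) \<in> {(1, 2), (3, 1), (1, 4), (5, 1), (1, 6)} then 1
      else if (i, j) \<in> {(2, 3), (4, 5)} then 2
      else 0)"

definition X6 :: "nat matrix" where
  "X6 i j = int (X6_arrows i j) - int (X6_arrows j i)"

definition Gamma_X6 :: "nat word set monoid" where
  "Gamma_X6 = saturated_modular_group X6_vertices X6"

definition alpha1_word :: "nat word" where
  "alpha1_word = [Perm (cycle_of_list [2, 3]), Mut 2]"

definition beta1_word :: "nat word" where
  "beta1_word = [Perm (cycle_of_list [1, 5, 2, 6, 3, 4]), Mut 4, Mut 2, Mut 4, Mut 3, Mut 1]"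

definition alpha1 :: "nat word set" where
  "alpha1 = loop_class X6_vertices X6 alpha1_word"

definition beta1 :: "nat word set" where
  "beta1 = loop_class X6_vertices X6 beta1_word"

section \<open>The saturated cluster modular group is a group\<close>

lemma words_Nil [simp]: "[] \<in> words I"
  and words_append [simp]: "u @ v \<in> words I \<longleftrightarrow> u \<in> words I \<and> v \<in> words I"
  and words_Cons: "l # v \<in> words I \<longleftrightarrow> [l] \<in> words I \<and> v \<in> words I"
  by (auto simp: words_def)

lemma words_Mut [simp]: "[Mut k] \<in> words I \<longleftrightarrow> k \<in> I"
  and words_Perm [simp]: "[Perm \<sigma>] \<in> words I \<longleftrightarrow> \<sigma> permutes I"
  by (auto simp: words_def)

lemma apply_word_Nil [simp]: "apply_word [] \<epsilon> = \<epsilon>"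
  and apply_word_Cons [simp]: "apply_word (l # w) \<epsilon> = apply_letter l (apply_word w \<epsilon>)"
  and apply_word_append [simp]: "apply_word (u @ v) \<epsilon> = apply_word u (apply_word v \<epsilon>)"
  by (simp_all add: apply_word_def)

lemma half_sum:
  "(\<bar>a\<bar> * b + a * \<bar>b\<bar>) div 2 =
     (if a > 0 \<and> b > 0 then a * b else if a < 0 \<and> b < 0 then - (a * b) else (0::int))"
  by (cases a "0::int" rule: linorder_cases; cases b "0::int" rule: linorder_cases) auto

lemma exchange_matrix_mutate:
  assumes "exchange_matrix I \<epsilon>" "k \<in> I"
  shows "exchange_matrix I (mutate k \<epsilon>)"
proof -
  have fin: "finite I" and sk: "\<epsilon> i j = - \<epsilon> j i" and out: "i \<notin> I \<or> j \<notin> I \<Longrightarrow> \<epsilon> i j = 0" for i j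
    using assms(1) unfolding exchange_matrix_def by blast+
  have "mutate k \<epsilon> i j = - mutate k \<epsilon> j i" for i j
  proof (cases "i = k \<or> j = k")
    case True
    then have "mutate k \<epsilon> i j = - \<epsilon> i j" "mutate k \<epsilon> j i = - \<epsilon> j i"
      by (auto simp: mutate_def)
    then show ?thesis using sk[of i j] by linarith
  next
    case False
    have e: "\<epsilon> j k = - \<epsilon> k j" "\<epsilon> k i = - \<epsilon> i k" "\<epsilon> j i = - \<epsilon> i j"
      by (rule sk)+
    show ?thesis unfolding mutate_def half_sum e using False by (simp add: mult.commute)
  qed
  moreover have "mutate k \<epsilon> i j = 0" if "i \<notin> I \<or> j \<notin> I" for i j
    unfolding mutate_def half_sum using that out by auto
  ultimately show ?thesis using fin unfolding exchange_matrix_def by blast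
qed

lemma exchange_matrix_permute:
  assumes "exchange_matrix I \<epsilon>" "\<sigma> permutes I"
  shows "exchange_matrix I (permute_matrix \<sigma> \<epsilon>)"
  using assms(1) permutes_in_image[OF permutes_inv[OF assms(2)]]
  unfolding exchange_matrix_def permute_matrix_def by blast

lemma mutate_mutate:
  "mutate k (mutate k \<epsilon>) = \<epsilon>"
  by (intro ext) (auto simp: mutate_def half_sum)

lemma permute_matrix_inv:
  assumes "\<sigma> permutes I"
  shows "permute_matrix (inv_into UNIV \<sigma>) (permute_matrix \<sigma> \<epsilon>) = \<epsilon>"
  using assms by (auto simp: permute_matrix_def permutes_inv_inv permutes_inverses)

lemma exchange_matrix_apply_word:
  assumes "exchange_matrix I \<epsilon>" "w \<in> words I"
  shows "exchange_matrix I (apply_word w \<epsilon>)"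
  using assms(2)
proof (induction w)
  case (Cons l w)
  then have "[l] \<in> words I" "exchange_matrix I (apply_word w \<epsilon>)"
    using words_Cons[of l w I] by simp_all
  then show ?case
    by (cases l) (auto intro: exchange_matrix_mutate exchange_matrix_permute)
qed (use assms(1) in simp)

fun inverse_letter :: "'a letter \<Rightarrow> 'a letter" where
  "inverse_letter (Mut k) = Mut k"
| "inverse_letter (Perm \<sigma>) = Perm (inv_into UNIV \<sigma>)"

definition inverse_word :: "'a word \<Rightarrow> 'a word" where
  "inverse_word w = rev (map inverse_letter w)"

lemma inverse_word_simps [simp]:
  "inverse_word [] = []" "inverse_word (l # w) = inverse_word w @ [inverse_letter l]"
  by (simp_all add: inverse_word_def)

lemma inverse_letter_in_words: "[l] \<in> words I \<Longrightarrow> [inverse_letter l] \<in> words I"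
  by (cases l) (auto intro: permutes_inv)

lemma inverse_word_in_words: "w \<in> words I \<Longrightarrow> inverse_word w \<in> words I"
proof (induction w)
  case (Cons l w)
  then show ?case using inverse_letter_in_words[of l I] words_Cons[of l w I] by simp
qed simp

lemma apply_inverse_word:
  assumes "w \<in> words I"
  shows "apply_word (inverse_word w) (apply_word w \<epsilon>) = \<epsilon>"
  using assms
proof (induction w)
  case (Cons l w)
  then have l: "[l] \<in> words I" and w: "w \<in> words I"
    using words_Cons[of l w I] by simp_all
  have "apply_letter (inverse_letter l) (apply_letter l (apply_word w \<epsilon>)) = apply_word w \<epsilon>"
    using l by (cases l) (auto simp: mutate_mutate permute_matrix_inv)
  then show ?case using Cons.IH[OF w] by simp
qed simp

lemma inverse_word_loop:
  assumes "w \<in> mutation_loops I \<epsilon>"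
  shows "inverse_word w \<in> mutation_loops I \<epsilon>"
  using assms apply_inverse_word[of w I \<epsilon>]
  by (auto simp: mutation_loops_def inverse_word_in_words)

lemma mutation_loops_append:
  "u \<in> mutation_loops I \<epsilon> \<Longrightarrow> v \<in> mutation_loops I \<epsilon> \<Longrightarrow> u @ v \<in> mutation_loops I \<epsilon>"
  by (auto simp: mutation_loops_def)


lemma elementary_move_append:
  assumes "elementary_move I \<epsilon> x y" "u \<in> words I" "v \<in> mutation_loops I \<epsilon>"
  shows "elementary_move I \<epsilon> (u @ x @ v) (u @ y @ v)"
  using assms(1)
proof cases
  case (1 u' v' x' y')
  have "elementary_move I \<epsilon> ((u @ u') @ x' @ (v' @ v)) ((u @ u') @ y' @ (v' @ v))"
    by (rule elementary_move.intros) (use 1 assms in \<open>auto simp: mutation_loops_def\<close>)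
  then show ?thesis by (simp add: 1)
qed

lemma loop_equiv_iff:
  "(x, y) \<in> loop_equiv I \<epsilon> \<longleftrightarrow> x \<in> mutation_loops I \<epsilon> \<and> y \<in> mutation_loops I \<epsilon> \<and>
     equivclp (\<lambda>x y. x \<in> mutation_loops I \<epsilon> \<and> y \<in> mutation_loops I \<epsilon> \<and>
       elementary_move I \<epsilon> x y) x y"
  by (simp add: loop_equiv_def)

lemma equiv_loop_equiv: "equiv (mutation_loops I \<epsilon>) (loop_equiv I \<epsilon>)"
proof (rule equivI)
  show "loop_equiv I \<epsilon> \<subseteq> mutation_loops I \<epsilon> \<times> mutation_loops I \<epsilon>"
    by (auto simp: loop_equiv_def)
  show "refl_on (mutation_loops I \<epsilon>) (loop_equiv I \<epsilon>)"
    by (auto simp: refl_on_def loop_equiv_def)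
  show "sym (loop_equiv I \<epsilon>)"
    unfolding sym_def loop_equiv_iff by (meson equivclp_sym)
  show "trans (loop_equiv I \<epsilon>)"
  proof (rule transI)
    fix x y z assume "(x, y) \<in> loop_equiv I \<epsilon>" "(y, z) \<in> loop_equiv I \<epsilon>"
    then show "(x, z) \<in> loop_equiv I \<epsilon>"
      unfolding loop_equiv_iff by (meson equivclp_trans)
  qed
qed

lemma loop_equiv_append:
  assumes "(x, y) \<in> loop_equiv I \<epsilon>" "u \<in> mutation_loops I \<epsilon>" "v \<in> mutation_loops I \<epsilon>"
  shows "(u @ x @ v, u @ y @ v) \<in> loop_equiv I \<epsilon>"
proof -
  let ?r = "\<lambda>x y. x \<in> mutation_loops I \<epsilon> \<and> y \<in> mutation_loops I \<epsilon> \<and> elementary_move I \<epsilon> x y"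
  have uw: "u \<in> words I" using assms(2) by (simp add: mutation_loops_def)
  have "equivclp ?r x y" using assms(1) by (simp add: loop_equiv_iff)
  then have "equivclp ?r (u @ x @ v) (u @ y @ v)"
  proof (induction rule: equivclp_induct)
    case (step y z)
    have "?r (u @ a @ v) (u @ b @ v)" if "?r a b" for a b
      using that elementary_move_append[OF _ uw assms(3)] assms
      by (auto intro!: mutation_loops_append)
    then have "?r (u @ y @ v) (u @ z @ v) \<or> ?r (u @ z @ v) (u @ y @ v)"
      using step.hyps by blast
    then show ?case by (rule equivclp_into_equivclp[OF step.IH])
  qed simp
  then show ?thesis
    using assms by (auto simp: loop_equiv_iff intro!: mutation_loops_append)
qed

lemma loop_equiv_append2:
  assumes "(x, x') \<in> loop_equiv I \<epsilon>" "(y, y') \<in> loop_equiv I \<epsilon>"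
  shows "(x @ y, x' @ y') \<in> loop_equiv I \<epsilon>"
proof -
  have Nil: "[] \<in> mutation_loops I \<epsilon>" by (simp add: mutation_loops_def)
  have "(x @ y, x' @ y) \<in> loop_equiv I \<epsilon>" "(x' @ y, x' @ y') \<in> loop_equiv I \<epsilon>"
    using loop_equiv_append[OF assms(1) Nil, of y] loop_equiv_append[OF assms(2) _ Nil, of x'] assms
    by (auto simp: loop_equiv_iff)
  then show ?thesis using equiv_loop_equiv[of I \<epsilon>] by (meson equivE transE)
qed

lemma loop_equiv_inverse:
  assumes "w \<in> mutation_loops I \<epsilon>"
  shows "(inverse_word w @ w, []) \<in> loop_equiv I \<epsilon>"
proof -
  let ?L = "mutation_loops I \<epsilon>"
  let ?r = "\<lambda>x y. x \<in> ?L \<and> y \<in> ?L \<and> elementary_move I \<epsilon> x y"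
  have loop: "inverse_word v @ v \<in> ?L" if "v \<in> words I" for v
    using that apply_inverse_word[OF that] inverse_word_in_words[OF that]
    by (simp add: mutation_loops_def)
  have "w \<in> words I" using assms by (simp add: mutation_loops_def)
  then have "equivclp ?r (inverse_word w @ w) []"
  proof (induction w)
    case (Cons l w)
    have l: "[l] \<in> words I" and w: "w \<in> words I" and lw: "l # w \<in> words I"
      using Cons.prems words_Cons[of l w I] by simp_all
    have u: "inverse_word w \<in> words I" using w by (rule inverse_word_in_words)
    have move: "elementary_move I \<epsilon> (inverse_word w @ x @ w) (inverse_word w @ y @ w)"
      if "elementary_relation I (apply_word w \<epsilon>) x y" for x y
      using u w that by (rule elementary_move.intros)
    have "equivclp ?r (inverse_word w @ [inverse_letter l, l] @ w) (inverse_word w @ w)"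
    proof (cases l)
      case (Mut k)
      have "?r (inverse_word w @ [inverse_letter l, l] @ w) (inverse_word w @ [] @ w)"
        using move[OF involution, of k] l loop[OF lw] loop[OF w] Mut by simp
      then show ?thesis by (simp add: r_into_equivclp)
    next
      case (Perm \<sigma>)
      have \<sigma>: "\<sigma> permutes I" using l Perm by simp
      have id: "inv_into UNIV \<sigma> \<circ> \<sigma> = id" using permutes_inv_o(2)[OF \<sigma>] .
      have 0: "inverse_word w @ [Perm id] @ w \<in> ?L"
        using loop[OF w] u w by (simp add: mutation_loops_def permute_matrix_def permutes_id words_Cons[of "Perm id" w])
      have "?r (inverse_word w @ [inverse_letter l, l] @ w) (inverse_word w @ [Perm id] @ w)"
        using move[OF perm_comp[OF permutes_inv[OF \<sigma>] \<sigma>]] 0 loop[OF lw] Perm id by simp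
      moreover have "?r (inverse_word w @ [Perm id] @ w) (inverse_word w @ [] @ w)"
        using move[OF perm_id] 0 loop[OF w] by simp
      ultimately show ?thesis
        using equivclp_trans[of ?r, OF r_into_equivclp[of ?r] r_into_equivclp[of ?r]]
        unfolding append_Nil by blast
    qed
    then show ?case using Cons.IH[OF w] by (simp add: equivclp_trans)
  qed simp
  then show ?thesis
    using loop[of w] assms by (simp add: loop_equiv_iff mutation_loops_def)
qed

lemma loop_class_eq_iff:
  assumes "x \<in> mutation_loops I \<epsilon>" "y \<in> mutation_loops I \<epsilon>"
  shows "loop_class I \<epsilon> x = loop_class I \<epsilon> y \<longleftrightarrow> (x, y) \<in> loop_equiv I \<epsilon>"
  using eq_equiv_class_iff[OF equiv_loop_equiv assms] by (simp add: loop_class_def)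

lemma mult_loop_class:
  assumes "x \<in> mutation_loops I \<epsilon>" "y \<in> mutation_loops I \<epsilon>"
  shows "loop_class I \<epsilon> x \<otimes>\<^bsub>saturated_modular_group I \<epsilon>\<^esub> loop_class I \<epsilon> y = loop_class I \<epsilon> (x @ y)"
proof -
  have eq: "loop_class I \<epsilon> (a @ b) = loop_class I \<epsilon> (x @ y)"
    if "a \<in> loop_class I \<epsilon> x" "b \<in> loop_class I \<epsilon> y" for a b
  proof -
    have "(x, a) \<in> loop_equiv I \<epsilon>" "(y, b) \<in> loop_equiv I \<epsilon>"
      using that by (simp_all add: loop_class_def)
    then have "(x @ y, a @ b) \<in> loop_equiv I \<epsilon>" by (rule loop_equiv_append2)
    then show ?thesis
      unfolding loop_class_def by (rule equiv_class_eq[OF equiv_loop_equiv, symmetric])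
  qed
  have ne: "loop_class I \<epsilon> x \<noteq> {}" "loop_class I \<epsilon> y \<noteq> {}"
    using assms equiv_class_self[OF equiv_loop_equiv] unfolding loop_class_def by blast+
  have "(\<Union>a\<in>loop_class I \<epsilon> x. \<Union>b\<in>loop_class I \<epsilon> y. loop_class I \<epsilon> (a @ b)) =
      (\<Union>a\<in>loop_class I \<epsilon> x. \<Union>b\<in>loop_class I \<epsilon> y. loop_class I \<epsilon> (x @ y))"
    by (intro SUP_cong refl eq)
  also have "\<dots> = loop_class I \<epsilon> (x @ y)" using ne by simp
  finally show ?thesis by (simp add: saturated_modular_group_def)
qed

lemma carrier_saturated_modular_group:
  "carrier (saturated_modular_group I \<epsilon>) = loop_class I \<epsilon> ` mutation_loops I \<epsilon>"
  by (auto simp: saturated_modular_group_def quotient_def loop_class_def)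

theorem group_saturated_modular_group: "group (saturated_modular_group I \<epsilon>)"
proof -
  let ?G = "saturated_modular_group I \<epsilon>"
  have Nil: "[] \<in> mutation_loops I \<epsilon>" by (simp add: mutation_loops_def)
  have one: "\<one>\<^bsub>?G\<^esub> = loop_class I \<epsilon> []" by (simp add: saturated_modular_group_def)
  show ?thesis
  proof (rule groupI)
    show "\<exists>y\<in>carrier ?G. y \<otimes>\<^bsub>?G\<^esub> x = \<one>\<^bsub>?G\<^esub>" if x: "x \<in> carrier ?G" for x
    proof -
      obtain w where w: "w \<in> mutation_loops I \<epsilon>" "x = loop_class I \<epsilon> w"
        using x by (auto simp: carrier_saturated_modular_group)
      have "loop_class I \<epsilon> (inverse_word w @ w) = loop_class I \<epsilon> []"
        using w Nil loop_equiv_inverse[OF w(1)] inverse_word_loop[OF w(1)]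
        by (simp add: loop_class_eq_iff mutation_loops_append)
      then show ?thesis
        using w inverse_word_loop[OF w(1)]
        by (auto simp: carrier_saturated_modular_group one mult_loop_class)
    qed
  qed (use Nil in \<open>auto simp: carrier_saturated_modular_group one mult_loop_class mutation_loops_append\<close>)
qed

section \<open>The elements \<open>\<alpha>\<^sub>1\<close> and \<open>\<beta>\<^sub>1\<close> are mutation loops\<close>

lemma exchange_matrix_X6: "exchange_matrix X6_vertices X6"
proof -
  have "X6_arrows i j = 0" if "i \<notin> X6_vertices \<or> j \<notin> X6_vertices" for i j
    using that by (auto simp: X6_vertices_def X6_arrows_def)
  moreover have "finite X6_vertices" by (simp add: X6_vertices_def)
  ultimately show ?thesis
    unfolding exchange_matrix_def X6_def by (metis diff_self minus_diff_eq of_nat_0)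
qed

lemma permute_matrix_eqI:
  assumes "\<sigma> permutes I" "exchange_matrix I \<epsilon>" "exchange_matrix I \<epsilon>'"
    and eq: "\<forall>i\<in>I. \<forall>j\<in>I. \<epsilon> i j = \<epsilon>' (\<sigma> i) (\<sigma> j)"
  shows "permute_matrix \<sigma> \<epsilon> = \<epsilon>'"
proof (intro ext)
  fix i j
  let ?i = "inv_into UNIV \<sigma> i" and ?j = "inv_into UNIV \<sigma> j"
  have out: "\<epsilon> a b = 0" "\<epsilon>' a b = 0" if "a \<notin> I \<or> b \<notin> I" for a b
    using assms(2,3) that unfolding exchange_matrix_def by blast+
  have "\<epsilon> ?i ?j = \<epsilon>' (\<sigma> ?i) (\<sigma> ?j)"
  proof (cases "?i \<in> I \<and> ?j \<in> I")
    case False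
    then have "\<sigma> ?i \<notin> I \<or> \<sigma> ?j \<notin> I" using permutes_in_image[OF assms(1)] by blast
    then show ?thesis using out False by presburger
  qed (use eq in blast)
  then show "permute_matrix \<sigma> \<epsilon> i j = \<epsilon>' i j"
    by (simp add: permute_matrix_def permutes_inverses[OF assms(1)])
qed

lemma X6_loopI:
  assumes "set cs \<subseteq> X6_vertices" "w \<in> words X6_vertices"
    and "\<forall>i\<in>{1,2,3,4,5,6}. \<forall>j\<in>{1,2,3,4,5,6}.
      apply_word w X6 i j = X6 (cycle_of_list cs i) (cycle_of_list cs j)"
  shows "Perm (cycle_of_list cs) # w \<in> mutation_loops X6_vertices X6"
proof -
  have perm: "cycle_of_list cs permutes X6_vertices"
    using cycle_permutes assms(1) by (rule permutes_subset)
  have V: "X6_vertices = {1,2,3,4,5,6}" by (auto simp: X6_vertices_def)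
  have "permute_matrix (cycle_of_list cs) (apply_word w X6) = X6"
    using perm exchange_matrix_apply_word[OF exchange_matrix_X6 assms(2)] exchange_matrix_X6
    by (rule permute_matrix_eqI) (use assms(3) in \<open>unfold V\<close>)
  then show ?thesis
    using perm assms(2) words_Cons[of "Perm (cycle_of_list cs)" w X6_vertices]
    by (simp add: mutation_loops_def)
qed

lemma alpha1_loop: "alpha1_word \<in> mutation_loops X6_vertices X6"
  unfolding alpha1_word_def
  by (rule X6_loopI)
     (simp_all add: X6_vertices_def mutate_def X6_def X6_arrows_def transpose_def)

text \<open>Explicit tables for following \<open>\<beta>\<^sub>1\<close> through its intermediate matrices.\<close>

definition table_matrix :: "int list list \<Rightarrow> nat matrix" where
  "table_matrix R = (\<lambda>i j. if i \<in> {1..6} \<and> j \<in> {1..6} then R ! (i - 1) ! (j - 1) else 0)"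

lemma interval_1_6: "{1..6} = {1, 2, 3, 4, 5, 6 :: nat}"
  by auto

lemma table_matrix_outside:
  "a \<notin> {1..6} \<or> b \<notin> {1..6} \<Longrightarrow> table_matrix R a b = 0"
  unfolding table_matrix_def by presburger

lemma mutate_table_matrix:
  assumes "k \<in> {1..6}"
    and "\<forall>i\<in>{1,2,3,4,5,6}. \<forall>j\<in>{1,2,3,4,5,6}.
      mutate k (table_matrix R) i j = table_matrix R' i j"
  shows "mutate k (table_matrix R) = table_matrix R'"
proof (intro ext)
  fix i j
  show "mutate k (table_matrix R) i j = table_matrix R' i j"
  proof (cases "i \<in> {1..6} \<and> j \<in> {1..6}")
    case True
    then show ?thesis using assms(2) unfolding interval_1_6 by blast
  next
    case False
    have "table_matrix R i j = 0" "table_matrix R' i j = 0"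
      "table_matrix R i k = 0 \<or> table_matrix R k j = 0"
      using False table_matrix_outside by blast+
    then show ?thesis by (auto simp: mutate_def)
  qed
qed

lemma X6_table:
  "X6 = table_matrix
     [[0, 1, - 1, 1, - 1, 1],
      [- 1, 0, 2, 0, 0, 0],
      [1, - 2, 0, 0, 0, 0],
      [- 1, 0, 0, 0, 2, 0],
      [1, 0, 0, - 2, 0, 0],
      [- 1, 0, 0, 0, 0, 0]]"
proof (intro ext)
  fix i j
  show "X6 i j = table_matrix
     [[0, 1, - 1, 1, - 1, 1],
      [- 1, 0, 2, 0, 0, 0],
      [1, - 2, 0, 0, 0, 0],
      [- 1, 0, 0, 0, 2, 0],
      [1, 0, 0, - 2, 0, 0],
      [- 1, 0, 0, 0, 0, 0]] i j"
  proof (cases "i \<in> {1..6} \<and> j \<in> {1..6}")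
    case True
    then show ?thesis unfolding interval_1_6
      by (elim conjE insertE emptyE) (simp_all add: X6_def X6_arrows_def table_matrix_def)
  next
    case False
    then have "i \<notin> X6_vertices \<or> j \<notin> X6_vertices" by (simp add: X6_vertices_def)
    then have "X6 i j = 0" using exchange_matrix_X6 unfolding exchange_matrix_def by blast
    moreover have "table_matrix R i j = 0" for R
      using False by (intro table_matrix_outside) blast
    ultimately show ?thesis by simp
  qed
qed

lemma beta1_step1:
  "mutate 1 (table_matrix
     [[0, 1, - 1, 1, - 1, 1],
      [- 1, 0, 2, 0, 0, 0],
      [1, - 2, 0, 0, 0, 0],
      [- 1, 0, 0, 0, 2, 0],
      [1, 0, 0, - 2, 0, 0],
      [- 1, 0, 0, 0, 0, 0]]) =
   table_matrix
     [[0, - 1, 1, - 1, 1, - 1],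
      [1, 0, 1, 0, - 1, 0],
      [- 1, - 1, 0, 1, 0, 1],
      [1, 0, - 1, 0, 1, 0],
      [- 1, 1, 0, - 1, 0, 1],
      [1, 0, - 1, 0, - 1, 0]]"
  by (rule mutate_table_matrix) (simp_all add: mutate_def table_matrix_def)

lemma beta1_step2:
  "mutate 3 (table_matrix
     [[0, - 1, 1, - 1, 1, - 1],
      [1, 0, 1, 0, - 1, 0],
      [- 1, - 1, 0, 1, 0, 1],
      [1, 0, - 1, 0, 1, 0],
      [- 1, 1, 0, - 1, 0, 1],
      [1, 0, - 1, 0, - 1, 0]]) =
   table_matrix
     [[0, - 1, - 1, 0, 1, 0],
      [1, 0, - 1, 1, - 1, 1],
      [1, 1, 0, - 1, 0, - 1],
      [0, - 1, 1, 0, 1, 0],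
      [- 1, 1, 0, - 1, 0, 1],
      [0, - 1, 1, 0, - 1, 0]]"
  by (rule mutate_table_matrix) (simp_all add: mutate_def table_matrix_def)

lemma beta1_step3:
  "mutate 4 (table_matrix
     [[0, - 1, - 1, 0, 1, 0],
      [1, 0, - 1, 1, - 1, 1],
      [1, 1, 0, - 1, 0, - 1],
      [0, - 1, 1, 0, 1, 0],
      [- 1, 1, 0, - 1, 0, 1],
      [0, - 1, 1, 0, - 1, 0]]) =
   table_matrix
     [[0, - 1, - 1, 0, 1, 0],
      [1, 0, 0, - 1, 0, 1],
      [1, 0, 0, 1, 0, - 1],
      [0, 1, - 1, 0, - 1, 0],
      [- 1, 0, 0, 1, 0, 1],
      [0, - 1, 1, 0, - 1, 0]]"
  by (rule mutate_table_matrix) (simp_all add: mutate_def table_matrix_def)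

lemma beta1_step4:
  "mutate 2 (table_matrix
     [[0, - 1, - 1, 0, 1, 0],
      [1, 0, 0, - 1, 0, 1],
      [1, 0, 0, 1, 0, - 1],
      [0, 1, - 1, 0, - 1, 0],
      [- 1, 0, 0, 1, 0, 1],
      [0, - 1, 1, 0, - 1, 0]]) =
   table_matrix
     [[0, 1, - 1, - 1, 1, 0],
      [- 1, 0, 0, 1, 0, - 1],
      [1, 0, 0, 1, 0, - 1],
      [1, - 1, - 1, 0, - 1, 1],
      [- 1, 0, 0, 1, 0, 1],
      [0, 1, 1, - 1, - 1, 0]]"
  by (rule mutate_table_matrix) (simp_all add: mutate_def table_matrix_def)

lemma beta1_step5:
  "mutate 4 (table_matrix
     [[0, 1, - 1, - 1, 1, 0],
      [- 1, 0, 0, 1, 0, - 1],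
      [1, 0, 0, 1, 0, - 1],
      [1, - 1, - 1, 0, - 1, 1],
      [- 1, 0, 0, 1, 0, 1],
      [0, 1, 1, - 1, - 1, 0]]) =
   table_matrix
     [[0, 0, - 2, 1, 0, 0],
      [0, 0, 0, - 1, 0, 0],
      [2, 0, 0, - 1, 0, 0],
      [- 1, 1, 1, 0, 1, - 1],
      [0, 0, 0, - 1, 0, 2],
      [0, 0, 0, 1, - 2, 0]]"
  by (rule mutate_table_matrix) (simp_all add: mutate_def table_matrix_def)

lemma beta1_loop: "beta1_word \<in> mutation_loops X6_vertices X6"
proof -
  have w: "[Mut 4] @ [Mut 2] @ [Mut 4] @ [Mut 3] @ [Mut 1] \<in> words X6_vertices"
    unfolding words_append words_Mut by (simp add: X6_vertices_def)
  have eq: "apply_word [Mut 4, Mut 2, Mut 4, Mut 3, Mut 1] X6 = table_matrix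
     [[0, 0, - 2, 1, 0, 0],
      [0, 0, 0, - 1, 0, 0],
      [2, 0, 0, - 1, 0, 0],
      [- 1, 1, 1, 0, 1, - 1],
      [0, 0, 0, - 1, 0, 2],
      [0, 0, 0, 1, - 2, 0]]"
    by (simp only: apply_word_Cons apply_word_Nil apply_letter.simps X6_table
      beta1_step1 beta1_step2 beta1_step3 beta1_step4 beta1_step5)
  let ?cs = "[1, 5, 2, 6, 3, 4] :: nat list"
  have cyc: "cycle_of_list ?cs 1 = 5" "cycle_of_list ?cs 2 = 6"
    "cycle_of_list ?cs 3 = 4" "cycle_of_list ?cs 4 = 1"
    "cycle_of_list ?cs 5 = 2" "cycle_of_list ?cs 6 = 3"
    by (simp_all add: transpose_def)
  show ?thesis
    unfolding beta1_word_def
  proof (rule X6_loopI)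
    show "set [1, 5, 2, 6, 3, 4] \<subseteq> X6_vertices" by (simp add: X6_vertices_def)
    show "[Mut 4, Mut 2, Mut 4, Mut 3, Mut 1] \<in> words X6_vertices" using w by simp
  qed (unfold eq, unfold ball_simps cyc X6_table, simp add: table_matrix_def)
qed

lemma group_Gamma_X6: "group Gamma_X6"
  unfolding Gamma_X6_def by (rule group_saturated_modular_group)

lemma alpha1_carrier: "alpha1 \<in> carrier Gamma_X6" and beta1_carrier: "beta1 \<in> carrier Gamma_X6"
  using alpha1_loop beta1_loop
  by (simp_all add: Gamma_X6_def alpha1_def beta1_def carrier_saturated_modular_group)

end

theory Submission
  imports Defs
begin

text \<open>
  Up to relabelling, the mutation class of \<open>X\<^sub>6\<close> consists of five quivers
  \<open>Q\<^sub>0 = X\<^sub>6, Q\<^sub>1, \<dots>, Q\<^sub>4\<close>. All of them have the automorphism \<open>r = (2 4)(3 5)\<close>; it is the only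
  nontrivial one, except that the automorphism group of \<open>Q\<^sub>4\<close> is a symmetric group on three letters
  in which \<open>r\<close> is a transposition. So the saturated cluster modular group is the vertex group of a
  groupoid on five objects, generated by these automorphisms and by thirty edges, the mutations
  \<open>\<mu>\<^sub>k Q\<^sub>i = t Q\<^sub>j\<close>. Its abelianization is a matter of linear algebra over the edges.

  Lower bound. To every edge belong the relabelling \<open>t\<close>, which is determined up to an automorphism of
  \<open>Q\<^sub>j\<close>, and a weight \<open>f \<in> \<int>\<close>. Reading a word from \<open>X\<^sub>6\<close> while composing the relabellings and
  adding the weights leads to a state \<open>(i, p, n)\<close>: the current matrix is \<open>p Q\<^sub>i\<close>. With the relabellings
  and weights of the table below, both sides of every relation lead to the same state, up to the
  rotations of \<open>Q\<^sub>4\<close> (\<open>run_elementary_relation\<close>), and the steps respect the automorphisms together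
  with their parity (\<open>symmetric_run\<close>). A loop ends in a state \<open>(0, p, n)\<close> with \<open>p\<close> the identity or
  \<open>r\<close>, and the pair of \<open>n\<close> and \<open>[p = r]\<close>, its winding, defines a homomorphism to
  \<open>\<int> \<times> \<int>/2\<close> (\<open>winding_append\<close>). It maps \<open>\<alpha>\<^sub>1\<close> to \<open>(1, 0)\<close> and \<open>\<beta>\<^sub>1\<close> to \<open>(1, 1)\<close>, hence it is
  onto.

  Upper bound. After a choice of paths from \<open>X\<^sub>6\<close> to the \<open>Q\<^sub>i\<close>, every edge closes up to a loop. Its
  defect is the class of this loop in \<open>H\<^sub>1\<close>, divided by \<open>\<alpha>\<^sub>1\<close> to the power of the weight. The defect of
  a word is the product of the defects of its edges (\<open>holonomy_run\<close>), so that every relation becomes an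
  equation between defects. Involutions, one square and four pentagons, together with the symmetry
  \<open>r\<close>, suffice to see that all defects are trivial (\<open>defect_eq_one\<close>); here the rotations of \<open>Q\<^sub>4\<close>
  do no harm because they are commutators (\<open>symmetry_class_rotation\<close>). Therefore a loop with winding
  \<open>(n, m)\<close> has the class \<open>\<alpha>\<^sub>1\<^sup>n r\<^sup>m\<close> (\<open>h1_class_eq_winding\<close>). In particular the kernel of the winding
  is the commutator
  subgroup, and the classes of \<open>\<alpha>\<^sub>1\<close> and \<open>\<beta>\<^sub>1 = \<alpha>\<^sub>1 r\<close> generate.
\<close>

section \<open>The five quivers and the edges between them\<close>

definition quiver_rows :: "int list list list" where
  "quiver_rows =
  [[[0, 1, - 1, 1, - 1, 1],
    [- 1, 0, 2, 0, 0, 0],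
    [1, - 2, 0, 0, 0, 0],
    [- 1, 0, 0, 0, 2, 0],
    [1, 0, 0, - 2, 0, 0],
    [- 1, 0, 0, 0, 0, 0]],
   [[0, - 1, 1, - 1, 1, - 1],
    [1, 0, 1, 0, - 1, 0],
    [- 1, - 1, 0, 1, 0, 1],
    [1, 0, - 1, 0, 1, 0],
    [- 1, 1, 0, - 1, 0, 1],
    [1, 0, - 1, 0, - 1, 0]],
   [[0, 1, - 1, 1, - 1, - 1],
    [- 1, 0, 2, 0, 0, 0],
    [1, - 2, 0, 0, 0, 0],
    [- 1, 0, 0, 0, 2, 0],
    [1, 0, 0, - 2, 0, 0],
    [1, 0, 0, 0, 0, 0]],
   [[0, - 1, 1, - 1, 1, 1],
    [1, 0, 1, 0, - 1, - 1],
    [- 1, - 1, 0, 1, 0, 0],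
    [1, 0, - 1, 0, 1, - 1],
    [- 1, 1, 0, - 1, 0, 0],
    [- 1, 1, 0, 1, 0, 0]],
   [[0, - 1, 0, - 1, 0, 1],
    [1, 0, 1, 0, - 1, 0],
    [0, - 1, 0, 1, 0, - 1],
    [1, 0, - 1, 0, 1, 0],
    [0, 1, 0, - 1, 0, - 1],
    [- 1, 0, 1, 0, 1, 0]]]"

definition quiver :: "nat \<Rightarrow> nat matrix" where
  "quiver i = table_matrix (quiver_rows ! i)"

text \<open>
  The entry of row \<open>i\<close> at the vertex \<open>k\<close> is \<open>(j, t, f)\<close> where \<open>\<mu>\<^sub>k Q\<^sub>i = t Q\<^sub>j\<close> and \<open>t\<close> is listed by its values at
  \<open>1, \<dots>, 6\<close>. The weights \<open>f\<close> solve the integral linear system that the square and pentagon relations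
  impose; they are normalised by giving \<open>\<alpha>\<^sub>1\<close> the weight \<open>1\<close> and by vanishing on the tree of edges
  \<open>Q\<^sub>0 - Q\<^sub>1\<close>, \<open>Q\<^sub>0 - Q\<^sub>2\<close>, \<open>Q\<^sub>2 - Q\<^sub>3\<close>, \<open>Q\<^sub>1 - Q\<^sub>4\<close>.
  Replacing \<open>t\<close> by \<open>t r\<close>, where \<open>r\<close> is the reflection below, shifts the \<open>\<int>/2\<close>-weight of the edge; the
  \<open>t\<close> are chosen to make all these weights zero, which is why only an integer is recorded.
\<close>

definition edge_table :: "(nat \<times> nat list \<times> int) list list" where
  "edge_table =
  [[(1, [1, 2, 3, 4, 5, 6], 0),
    (0, [1, 3, 2, 4, 5, 6], 1),
    (0, [1, 3, 2, 4, 5, 6], - 1),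
    (0, [1, 2, 3, 5, 4, 6], 1),
    (0, [1, 2, 3, 5, 4, 6], - 1),
    (2, [1, 2, 3, 4, 5, 6], 0)],
   [(0, [1, 2, 3, 4, 5, 6], 0),
    (3, [3, 1, 2, 5, 6, 4], 2),
    (3, [2, 3, 1, 5, 6, 4], 1),
    (3, [5, 3, 6, 1, 4, 2], 2),
    (3, [4, 3, 6, 5, 1, 2], 1),
    (4, [1, 2, 3, 4, 5, 6], 0)],
   [(3, [1, 2, 3, 4, 5, 6], 0),
    (2, [1, 3, 2, 4, 5, 6], 1),
    (2, [1, 3, 2, 4, 5, 6], - 1),
    (2, [1, 2, 3, 5, 4, 6], 1),
    (2, [1, 2, 3, 5, 4, 6], - 1),
    (0, [1, 2, 3, 4, 5, 6], 0)],
   [(2, [1, 2, 3, 4, 5, 6], 0),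
    (1, [3, 1, 2, 6, 4, 5], - 1),
    (1, [2, 3, 1, 6, 4, 5], - 2),
    (1, [5, 6, 2, 1, 4, 3], - 1),
    (1, [4, 6, 2, 5, 1, 3], - 2),
    (4, [3, 1, 5, 2, 6, 4], 0)],
   [(3, [6, 2, 3, 4, 5, 1], 0),
    (1, [5, 4, 1, 6, 3, 2], 0),
    (3, [4, 6, 5, 2, 1, 3], 0),
    (1, [3, 6, 5, 2, 1, 4], 0),
    (3, [2, 4, 1, 6, 3, 5], 0),
    (1, [1, 2, 3, 4, 5, 6], 0)]]"

text \<open>
  The state \<open>(i, p, n)\<close> stands for the matrix \<open>p Q\<^sub>i\<close> with accumulated weight \<open>n\<close>; an edge is read as
  the state that it leads to from \<open>(i, id, 0)\<close>.
\<close>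

type_synonym state = "nat \<times> nat list \<times> int"

definition edge :: "nat \<Rightarrow> nat \<Rightarrow> state" where
  "edge i k = edge_table ! i ! (k - 1)"

text \<open>
  A relabelling is stored as the list of its values, which keeps the tables executable. As a
  permutation it is the identity outside the vertices; \<open>position\<close> is its inverse on the vertices.
\<close>

definition perm_of :: "nat list \<Rightarrow> nat \<Rightarrow> nat" where
  "perm_of p k = (if 1 \<le> k \<and> k \<le> 6 then p ! (k - 1) else k)"

definition position :: "nat list \<Rightarrow> nat \<Rightarrow> nat" where
  "position p k = Suc (length (takeWhile (\<lambda>x. x \<noteq> k) p))"

definition arrangements :: "nat list set" where
  "arrangements = {p. distinct p \<and> set p = X6_vertices}"

definition ident :: "nat list" where
  "ident = [1, 2, 3, 4, 5, 6]"

definition start :: "nat \<Rightarrow> state" where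
  "start i = (i, ident, 0)"

text \<open>
  Relabelling from the left commutes with everything, so that a state is the translate of
  \<open>start i\<close> and each statement about states has to be checked at the five states \<open>start i\<close> only.
\<close>

definition translate :: "(nat \<Rightarrow> nat) \<Rightarrow> int \<Rightarrow> state \<Rightarrow> state" where
  "translate \<sigma> n = (\<lambda>(j, t, f). (j, map \<sigma> t, n + f))"

fun step :: "nat letter \<Rightarrow> state \<Rightarrow> state" where
  "step (Mut k) (i, p, n) = translate (perm_of p) n (edge i (position p k))"
| "step (Perm \<sigma>) (i, p, n) = (i, map \<sigma> p, n)"

definition run :: "nat word \<Rightarrow> state \<Rightarrow> state" where
  "run w st = foldr step w st"

definition states :: "state set" where
  "states = {..<5} \<times> arrangements \<times> UNIV"

fun state_matrix :: "state \<Rightarrow> nat matrix" where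
  "state_matrix (i, p, n) = permute_matrix (perm_of p) (quiver i)"

definition reflection :: "nat list" where
  "reflection = [1, 4, 5, 2, 3, 6]"

text \<open>
  The automorphisms of \<open>Q\<^sub>i\<close>, marked by their parity: the marked ones have the class of the reflection
  in homology, the unmarked ones become trivial.
\<close>

fun symmetries :: "nat \<Rightarrow> (nat list \<times> bool) list" where
  "symmetries i = [(ident, False), (reflection, True)] @
     (if i = 4 then [([3, 6, 5, 2, 1, 4], False), ([5, 4, 1, 6, 3, 2], False),
                     ([3, 2, 1, 6, 5, 4], True), ([5, 6, 3, 4, 1, 2], True)] else [])"

text \<open>
  Automorphisms act on states from the right.
\<close>

fun symmetric :: "bool \<Rightarrow> state \<Rightarrow> state \<Rightarrow> bool" where
  "symmetric m (i, p, n) (i', p', n') \<longleftrightarrow>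
     i = i' \<and> n = n' \<and> (\<exists>(c, b) \<in> set (symmetries i). b = m \<and> p' = map (perm_of p) c)"

lemma run_Nil [simp]: "run [] st = st"
  and run_Cons [simp]: "run (l # w) st = step l (run w st)"
  and run_append [simp]: "run (u @ w) st = run u (run w st)"
  by (simp_all add: run_def)

text \<open>
  The finite verifications. They confirm the tables, and they confirm that the choice of relabellings
  and weights is compatible with every relation and every automorphism.
\<close>

lemma mutate_entries_check:
  "\<forall>i\<in>set [0..<5]. \<forall>k\<in>set [1..<7]. case edge i k of (j, t, f) \<Rightarrow>
     (\<forall>a\<in>set [1..<7]. \<forall>b\<in>set [1..<7]. mutate k (quiver i) a b = quiver j (position t a) (position t b))"
  by code_simp

lemma edge_check:
  "\<forall>i\<in>set [0..<5]. \<forall>k\<in>set [1..<7]. case edge i k of (j, t, f) \<Rightarrow>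
     j < 5 \<and> distinct t \<and> set t = set [1..<7]"
  by code_simp

lemma involution_check:
  "\<forall>i\<in>set [0..<5]. \<forall>k\<in>set [1..<7]. symmetric False (run [Mut k, Mut k] (start i)) (start i)"
  by code_simp

lemma square_check:
  "\<forall>i\<in>set [0..<5]. \<forall>k\<in>set [1..<7]. \<forall>l\<in>set [1..<7]. quiver i k l = 0 \<longrightarrow>
     symmetric False (run [Mut k, Mut l] (start i)) (run [Mut l, Mut k] (start i))"
  by code_simp

lemma pentagon_check:
  "\<forall>i\<in>set [0..<5]. \<forall>k\<in>set [1..<7]. \<forall>l\<in>set [1..<7]. quiver i k l = 1 \<or> quiver i k l = - 1 \<longrightarrow>
     symmetric False (run [Mut k, Mut l, Mut k, Mut l, Mut k] (start i))
       (run [Perm (transpose k l)] (start i))"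
  by code_simp

lemma symmetry_check:
  "\<forall>i\<in>set [0..<5]. \<forall>k\<in>set [1..<7]. \<forall>(c, m)\<in>set (symmetries i).
     symmetric m (step (Mut k) (start i)) (step (Mut k) (i, c, 0))"
  by code_simp

section \<open>Arrangements and relabelling\<close>

lemma X6_vertices_set: "X6_vertices = set [1..<7]"
  by (auto simp: X6_vertices_def)

text \<open>
  Turns the executable form of the verifications into the form in which they are applied.
\<close>

lemma all_quivers_and_vertices:
  assumes "\<forall>i\<in>set [0..<5]. \<forall>k\<in>set [1..<7]. P i k" "i < 5" "k \<in> X6_vertices"
  shows "P i k"
  using assms unfolding X6_vertices_set by auto

lemma perm_of_permutes:
  assumes "p \<in> arrangements"
  shows "perm_of p permutes X6_vertices"
proof -
  have d: "distinct p" "set p = {1..6}"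
    using assms by (auto simp: arrangements_def X6_vertices_def)
  have len: "length p = 6" using distinct_card[OF d(1)] d(2) by simp
  have "bij_betw (\<lambda>k. p ! (k - 1)) {1..6} {1..6}"
  proof -
    have "bij_betw (\<lambda>k. k - 1) {1..6::nat} {..<6}"
      by (rule bij_betw_byWitness[where f' = Suc]) auto
    moreover have "bij_betw (\<lambda>i. p ! i) {..<6} {1..6}"
      using bij_betw_nth[of p "{..<6}" "{1..6}"] d len by simp
    ultimately show ?thesis by (auto dest: bij_betw_trans simp: comp_def)
  qed
  then have "bij_betw (perm_of p) {1..6} {1..6}"
    by (rule bij_betw_cong[THEN iffD1, rotated]) (simp add: perm_of_def)
  then show ?thesis
    unfolding X6_vertices_def by (rule bij_imp_permutes) (auto simp: perm_of_def)
qed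

lemma arrangement_length: "p \<in> arrangements \<Longrightarrow> length p = 6"
  using distinct_card[of p] by (simp add: arrangements_def X6_vertices_def)

lemma perm_of_position:
  assumes "p \<in> arrangements" "k \<in> X6_vertices"
  shows "position p k \<in> X6_vertices" "perm_of p (position p k) = k"
proof -
  have k: "k \<in> set p" using assms by (simp add: arrangements_def)
  then have l: "length (takeWhile (\<lambda>x. x \<noteq> k) p) < length p"
    by (induction p) auto
  show "position p k \<in> X6_vertices"
    using l arrangement_length[OF assms(1)] by (simp add: position_def X6_vertices_def)
  show "perm_of p (position p k) = k"
    using l arrangement_length[OF assms(1)] nth_length_takeWhile[OF l]
    by (simp add: perm_of_def position_def)
qed

lemma position_eq_iff:
  assumes "p \<in> arrangements" "k \<in> X6_vertices" "a \<in> X6_vertices"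
  shows "position p k = a \<longleftrightarrow> perm_of p a = k"
  using perm_of_position[OF assms(1,2)] permutes_inj[OF perm_of_permutes[OF assms(1)]]
  by (auto dest: injD)

lemma position_map:
  assumes "p \<in> arrangements" "\<sigma> permutes X6_vertices"
  shows "position (map \<sigma> p) (\<sigma> k) = position p k"
  using permutes_inj[OF assms(2)]
  by (simp add: position_def takeWhile_map comp_def inj_eq)

lemma map_arrangement:
  assumes "p \<in> arrangements" "\<sigma> permutes X6_vertices"
  shows "map \<sigma> p \<in> arrangements"
  using assms permutes_inj_on[OF assms(2)] permutes_image[OF assms(2)]
  by (auto simp: arrangements_def distinct_map)

lemma perm_of_map:
  assumes "p \<in> arrangements" "\<sigma> permutes X6_vertices"
  shows "perm_of (map \<sigma> p) = \<sigma> \<circ> perm_of p"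
proof
  fix k
  show "perm_of (map \<sigma> p) k = (\<sigma> \<circ> perm_of p) k"
    using arrangement_length[OF assms(1)] permutes_not_in[OF assms(2), of k]
    by (auto simp: perm_of_def X6_vertices_def)
qed

lemma ident_arrangement [simp]: "ident \<in> arrangements"
  by (auto simp: ident_def arrangements_def X6_vertices_def)

lemma perm_of_ident [simp]: "perm_of ident = id"
proof
  fix k :: nat
  have "k \<in> {1,2,3,4,5,6}" if "1 \<le> k" "k \<le> 6"
    using that unfolding interval_1_6[symmetric] by simp
  then show "perm_of ident k = id k" by (auto simp: perm_of_def ident_def)
qed

lemma map_perm_of_ident [simp]: "p \<in> arrangements \<Longrightarrow> map (perm_of p) ident = p"
  using arrangement_length[of p]
  by (auto simp: ident_def perm_of_def numeral_eq_Suc length_Suc_conv)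

lemma start_in_states: "i < 5 \<Longrightarrow> start i \<in> states"
  by (simp add: start_def states_def)

lemma translate_in_states:
  "st \<in> states \<Longrightarrow> \<sigma> permutes X6_vertices \<Longrightarrow> translate \<sigma> n st \<in> states"
  by (auto simp: states_def translate_def map_arrangement)

lemma translate_start: "p \<in> arrangements \<Longrightarrow> translate (perm_of p) n (start i) = (i, p, n)"
  by (simp add: translate_def start_def)

lemma edge_in_states:
  assumes "i < 5" "k \<in> X6_vertices"
  shows "edge i k \<in> states"
proof -
  obtain j t f where e: "edge i k = (j, t, f)" by (metis prod_cases3)
  have "case edge i k of (j, t, f) \<Rightarrow> j < 5 \<and> distinct t \<and> set t = X6_vertices"
    using all_quivers_and_vertices[OF edge_check assms] unfolding X6_vertices_set .
  then show ?thesis unfolding e states_def arrangements_def by simp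
qed

lemma step_in_states:
  assumes "[l] \<in> words X6_vertices" "st \<in> states"
  shows "step l st \<in> states"
proof (cases l)
  case (Mut k)
  obtain i p n where st: "st = (i, p, n)" by (metis prod_cases3)
  show ?thesis
    using assms unfolding Mut st words_Mut step.simps
    by (auto simp: states_def intro!: translate_in_states[unfolded states_def]
        edge_in_states[unfolded states_def] perm_of_permutes perm_of_position)
next
  case (Perm \<sigma>)
  then show ?thesis using assms by (auto simp: states_def map_arrangement)
qed

lemma run_in_states:
  "w \<in> words X6_vertices \<Longrightarrow> st \<in> states \<Longrightarrow> run w st \<in> states"
proof (induction w)
  case (Cons l w)
  then show ?case using words_Cons[of l w X6_vertices] by (simp add: step_in_states)
qed simp

lemma translate_translate:
  "translate \<sigma> m (translate \<tau> n st) = translate (\<sigma> \<circ> \<tau>) (m + n) st"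
  by (cases st) (simp add: translate_def)

text \<open>
  Equivariance under relabelling: the step at \<open>\<sigma> k\<close> looks up the edge of \<open>Q\<^sub>i\<close> at the vertex which
  the relabelled arrangement carries to \<open>\<sigma> k\<close>, and this is the vertex that \<open>p\<close> carries to \<open>k\<close>.
\<close>

lemma step_translate:
  assumes "k \<in> X6_vertices" "\<sigma> permutes X6_vertices" "st \<in> states"
  shows "step (Mut (\<sigma> k)) (translate \<sigma> n st) = translate \<sigma> n (step (Mut k) st)"
proof -
  obtain i p m where st: "st = (i, p, m)" by (metis prod_cases3)
  have p: "p \<in> arrangements" using assms(3) by (simp add: st states_def)
  show ?thesis
    unfolding st by (simp add: fun_cong[OF translate_def, of \<sigma> n "(i, p, m)"]
      perm_of_map[OF p assms(2)] position_map[OF p assms(2)] translate_translate)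
qed

lemma run_translate:
  assumes "set ks \<subseteq> X6_vertices" "\<sigma> permutes X6_vertices" "st \<in> states"
  shows "run (map (\<lambda>k. Mut (\<sigma> k)) ks) (translate \<sigma> n st) = translate \<sigma> n (run (map Mut ks) st)"
  using assms(1)
proof (induction ks)
  case (Cons k ks)
  have "map Mut ks \<in> words X6_vertices" using Cons.prems by (auto simp: words_def lists_eq_set)
  then show ?case using Cons assms(2,3) by (simp add: step_translate run_in_states)
qed simp

section \<open>States follow the matrices\<close>

lemma permute_matrix_comp:
  assumes "\<sigma> permutes I" "\<tau> permutes I"
  shows "permute_matrix \<sigma> (permute_matrix \<tau> \<epsilon>) = permute_matrix (\<sigma> \<circ> \<tau>) \<epsilon>"
  using assms by (simp add: permute_matrix_def o_inv_distrib permutes_bij)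

lemma mutate_permute_matrix:
  assumes "bij \<sigma>"
  shows "mutate (\<sigma> k) (permute_matrix \<sigma> \<epsilon>) = permute_matrix \<sigma> (mutate k \<epsilon>)"
proof -
  have "inv_into UNIV \<sigma> a = k \<longleftrightarrow> a = \<sigma> k" for a
    using assms by (metis bij_inv_eq_iff)
  then show ?thesis
    by (intro ext) (simp add: mutate_def permute_matrix_def inv_f_f[OF bij_is_inj[OF assms]])
qed

lemma exchange_matrix_quiver:
  assumes "i < 5"
  shows "exchange_matrix X6_vertices (quiver i)"
proof -
  have *: "\<forall>i\<in>set [0..<5]. \<forall>a\<in>set [1..<7]. \<forall>b\<in>set [1..<7]. quiver i a b = - quiver i b a"
    by code_simp
  have z: "quiver i a b = 0" if "a \<notin> X6_vertices \<or> b \<notin> X6_vertices" for a b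
    using that unfolding quiver_def X6_vertices_def by (rule table_matrix_outside)
  have "quiver i a b = - quiver i b a" for a b
  proof (cases "a \<in> X6_vertices \<and> b \<in> X6_vertices")
    case True
    then show ?thesis using all_quivers_and_vertices[OF * assms, of a] unfolding X6_vertices_set by blast
  next
    case False
    then show ?thesis using z[of a b] z[of b a] by auto
  qed
  moreover have "finite X6_vertices" by (simp add: X6_vertices_def)
  ultimately show ?thesis using z unfolding exchange_matrix_def by blast
qed

lemma quiver_0: "quiver 0 = X6"
  by (simp add: quiver_def quiver_rows_def X6_table)

lemma mutate_quiver:
  assumes "i < 5" "k \<in> X6_vertices"
  shows "state_matrix (edge i k) = mutate k (quiver i)"
proof -
  obtain j t f where e: "edge i k = (j, t, f)" by (metis prod_cases3)
  have j: "j < 5" and t: "t \<in> arrangements"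
    using edge_in_states[OF assms] by (simp_all add: e states_def)
  have "mutate k (quiver i) a b = quiver j (position t a) (position t b)"
    if "a \<in> X6_vertices" "b \<in> X6_vertices" for a b
    using all_quivers_and_vertices[OF mutate_entries_check assms] that e
    unfolding X6_vertices_set by simp
  then have eq: "quiver j a b = mutate k (quiver i) (perm_of t a) (perm_of t b)"
    if "a \<in> X6_vertices" "b \<in> X6_vertices" for a b
    using that permutes_in_image[OF perm_of_permutes[OF t]] position_eq_iff[OF t, of "perm_of t a" a]
      position_eq_iff[OF t, of "perm_of t b" b] by simp
  have "permute_matrix (perm_of t) (quiver j) = mutate k (quiver i)"
    using perm_of_permutes[OF t] exchange_matrix_quiver[OF j]
      exchange_matrix_mutate[OF exchange_matrix_quiver[OF assms(1)] assms(2)]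
    by (rule permute_matrix_eqI) (use eq in blast)
  then show ?thesis by (simp add: e)
qed

lemma state_matrix_translate:
  assumes "\<sigma> permutes X6_vertices" "st \<in> states"
  shows "state_matrix (translate \<sigma> n st) = permute_matrix \<sigma> (state_matrix st)"
  using assms permute_matrix_comp[OF assms(1) perm_of_permutes]
  by (auto simp: translate_def states_def perm_of_map)

text \<open>
  A state never loses track of its matrix; the case of a mutation is the table, translated.
\<close>

lemma state_matrix_step:
  assumes "[l] \<in> words X6_vertices" "st \<in> states"
  shows "state_matrix (step l st) = apply_letter l (state_matrix st)"
proof -
  obtain i p n where st: "st = (i, p, n)" by (metis prod_cases3)
  have p: "p \<in> arrangements" and i: "i < 5" using assms(2) by (simp_all add: st states_def)
  show ?thesis
  proof (cases l)
    case (Mut k)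
    have k: "k \<in> X6_vertices" using assms(1) Mut by simp
    have "mutate (perm_of p (position p k)) (permute_matrix (perm_of p) (quiver i)) =
        permute_matrix (perm_of p) (mutate (position p k) (quiver i))"
      by (rule mutate_permute_matrix) (rule permutes_bij[OF perm_of_permutes[OF p]])
    then show ?thesis
      using perm_of_position[OF p k] i
      by (simp add: Mut st state_matrix_translate perm_of_permutes[OF p] edge_in_states mutate_quiver)
  next
    case (Perm \<sigma>)
    have "\<sigma> permutes X6_vertices" using assms(1) Perm by simp
    then show ?thesis
      using p permute_matrix_comp[OF _ perm_of_permutes[OF p]] by (simp add: Perm st perm_of_map)
  qed
qed

lemma state_matrix_run:
  "w \<in> words X6_vertices \<Longrightarrow> st \<in> states \<Longrightarrow>
     state_matrix (run w st) = apply_word w (state_matrix st)"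
proof (induction w)
  case (Cons l w)
  then have "[l] \<in> words X6_vertices" "w \<in> words X6_vertices"
    using words_Cons[of l w] by simp_all
  then show ?case using Cons by (simp add: state_matrix_step run_in_states)
qed simp

lemma state_matrix_start [simp]: "state_matrix (start i) = quiver i"
  unfolding start_def state_matrix.simps perm_of_ident by (simp add: permute_matrix_def)

section \<open>States up to symmetry, and the relations\<close>

declare symmetries.simps [simp del]

lemma all_quivers_and_vertex_pairs:
  assumes "\<forall>i\<in>set [0..<5]. \<forall>k\<in>set [1..<7]. \<forall>l\<in>set [1..<7]. P i k l"
    "i < 5" "k \<in> X6_vertices" "l \<in> X6_vertices"
  shows "P i k l"
  using assms unfolding X6_vertices_set by auto

lemma symmetries_arrangements: "(c, m) \<in> set (symmetries i) \<Longrightarrow> c \<in> arrangements"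
  by (auto simp: symmetries.simps ident_def reflection_def arrangements_def X6_vertices_def split: if_splits)

lemma symmetric_translate:
  assumes "symmetric m st st'" "st \<in> states" "\<sigma> permutes X6_vertices"
  shows "symmetric m (translate \<sigma> n st) (translate \<sigma> n st')"
proof -
  obtain i p k where st: "st = (i, p, k)" by (metis prod_cases3)
  obtain i' p' k' where st': "st' = (i', p', k')" by (metis prod_cases3)
  have p: "p \<in> arrangements" using assms(2) by (simp add: st states_def)
  show ?thesis
    using assms(1) unfolding st st' translate_def
    by (simp only: symmetric.simps prod.case) (force simp: perm_of_map[OF p assms(3)])
qed

lemma symmetricE:
  assumes "symmetric m st st'" "st \<in> states"
  obtains i p n c where "st = translate (perm_of p) n (start i)" "st' = translate (perm_of p) n (i, c, 0)"
    "i < 5" "p \<in> arrangements" "(c, m) \<in> set (symmetries i)"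
proof -
  obtain i p n where st: "st = (i, p, n)" by (metis prod_cases3)
  obtain i' p' n' where st': "st' = (i', p', n')" by (metis prod_cases3)
  obtain c where "(c, m) \<in> set (symmetries i)" "p' = map (perm_of p) c" "i' = i" "n' = n"
    using assms(1) unfolding st st' symmetric.simps by blast
  moreover have "p \<in> arrangements" "i < 5" using assms(2) by (simp_all add: st states_def)
  ultimately show thesis
    using that[of p n i c] by (simp add: st st' translate_start) (simp add: translate_def)
qed

text \<open>
  By equivariance it suffices to start at \<open>(i, id, 0)\<close>, where the claim is a finite verification. Along
  an edge an automorphism may turn into a different one, such as the reflection of \<open>Q\<^sub>3\<close> into another
  transposition of \<open>Q\<^sub>4\<close>, but its parity stays the same.
\<close>

lemma symmetric_step:
  assumes "[l] \<in> words X6_vertices" "st \<in> states" "symmetric m st st'"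
  shows "symmetric m (step l st) (step l st')"
proof (cases l)
  case (Mut k)
  have k: "k \<in> X6_vertices" using assms(1) Mut by simp
  obtain i p n c where *: "st = translate (perm_of p) n (start i)" "st' = translate (perm_of p) n (i, c, 0)"
    "i < 5" "p \<in> arrangements" "(c, m) \<in> set (symmetries i)"
    using symmetricE[OF assms(3,2)] .
  let ?k = "position p k"
  have \<sigma>: "perm_of p permutes X6_vertices" using *(4) by (rule perm_of_permutes)
  have k': "?k \<in> X6_vertices" "perm_of p ?k = k" using perm_of_position[OF *(4) k] .
  have st0: "start i \<in> states" "(i, c, 0) \<in> states"
    using *(3) symmetries_arrangements[OF *(5)] by (simp_all add: start_in_states, simp add: states_def)
  have "symmetric m (step (Mut ?k) (start i)) (step (Mut ?k) (i, c, 0))"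
    using all_quivers_and_vertices[OF symmetry_check *(3) k'(1)] *(5) by blast
  then have "symmetric m (translate (perm_of p) n (step (Mut ?k) (start i)))
      (translate (perm_of p) n (step (Mut ?k) (i, c, 0)))"
    using \<sigma> k'(1) st0 by (intro symmetric_translate) (auto intro: step_in_states)
  then show ?thesis
    using step_translate[OF k'(1) \<sigma> st0(1), of n] step_translate[OF k'(1) \<sigma> st0(2), of n]
    by (simp add: Mut *(1,2) k'(2))
next
  case (Perm \<sigma>)
  have "step l st = translate \<sigma> 0 st" for st by (cases st) (simp add: Perm translate_def)
  then show ?thesis using symmetric_translate[OF assms(3,2)] assms(1) Perm by simp
qed

lemma symmetric_run:
  "w \<in> words X6_vertices \<Longrightarrow> st \<in> states \<Longrightarrow> symmetric m st st' \<Longrightarrow> symmetric m (run w st) (run w st')"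
proof (induction w)
  case (Cons l w)
  then show ?case using words_Cons[of l w X6_vertices] by (simp add: symmetric_step run_in_states)
qed simp

lemma symmetric_refl: "st \<in> states \<Longrightarrow> symmetric False st st"
  by (cases st) (auto simp: states_def symmetries.simps)

text \<open>
  The relations that only involve permutations hold for states on the nose, and so does the conjugation
  relation, by equivariance. The other three are translated to \<open>start i\<close> and verified there. At
  \<open>Q\<^sub>4\<close> rotations are unavoidable, already for the involution: the edges at \<open>2\<close>, \<open>4\<close> and \<open>6\<close> all lead
  to \<open>Q\<^sub>1\<close>, from where a single edge leads back.
\<close>

lemma run_elementary_relation:
  assumes rel: "elementary_relation X6_vertices (state_matrix st) x y" and st: "st \<in> states"
  shows "symmetric False (run x st) (run y st)"
proof -
  obtain i p n where ipn: "st = (i, p, n)" by (metis prod_cases3)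
  have i: "i < 5" and p: "p \<in> arrangements" using st by (simp_all add: ipn states_def)
  let ?\<sigma> = "perm_of p"
  have \<sigma>: "?\<sigma> permutes X6_vertices" using p by (rule perm_of_permutes)
  have st': "st = translate ?\<sigma> n (start i)" using p by (simp add: ipn translate_start)
  have si: "start i \<in> states" using i by (rule start_in_states)
  have w: "map Mut ks \<in> words X6_vertices" if "set ks \<subseteq> X6_vertices" for ks
    using that by (auto simp: words_def lists_eq_set)
  have move: "symmetric False (run (map Mut (map ?\<sigma> ks)) st) (run (map Mut (map ?\<sigma> ls)) st)"
    if "symmetric False (run (map Mut ks) (start i)) (run (map Mut ls) (start i))"
      "set ks \<subseteq> X6_vertices" "set ls \<subseteq> X6_vertices" for ks ls
    using symmetric_translate[OF that(1) run_in_states[OF w[OF that(2)] si] \<sigma>, of n]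
      run_translate[OF that(2) \<sigma> si, of n] run_translate[OF that(3) \<sigma> si, of n]
    by (simp add: st' comp_def)
  have pos: "position p k \<in> X6_vertices" "?\<sigma> (position p k) = k" if "k \<in> X6_vertices" for k
    using perm_of_position[OF p that] .
  have ent: "state_matrix st a b = quiver i (position p a) (position p b)"
    if "a \<in> X6_vertices" "b \<in> X6_vertices" for a b
  proof -
    have "inv_into UNIV ?\<sigma> k = position p k" if "k \<in> X6_vertices" for k
      using pos[OF that] permutes_inverses(2)[OF \<sigma>, of "position p k"] by simp
    then show ?thesis using that by (simp add: ipn permute_matrix_def)
  qed
  show ?thesis
    using rel
  proof cases
    case perm_id
    then show ?thesis using symmetric_refl[OF st] by (simp add: ipn)
  next
    case (perm_comp \<sigma> \<tau>)
    then have "step (Perm (\<sigma> \<circ> \<tau>)) st \<in> states" using st by (intro step_in_states) (auto intro: permutes_compose)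
    then show ?thesis using symmetric_refl[of "step (Perm (\<sigma> \<circ> \<tau>)) st"] perm_comp by (simp add: ipn)
  next
    case (involution k)
    then show ?thesis
      using move[of "[position p k, position p k]" "[]"] pos[of k]
        all_quivers_and_vertices[OF involution_check i, of "position p k"] by simp
  next
    case (conjugation \<tau> k)
    have "step (Mut k) (translate (inv_into UNIV \<tau>) 0 st) \<in> states"
      using conjugation st by (intro step_in_states translate_in_states permutes_inv) auto
    then have *: "step (Mut (\<tau> k)) (translate \<tau> 0 (translate (inv_into UNIV \<tau>) 0 st)) =
        translate \<tau> 0 (step (Mut k) (translate (inv_into UNIV \<tau>) 0 st))"
      using conjugation st by (intro step_translate translate_in_states permutes_inv) auto
    have P: "step (Perm \<rho>) s = translate \<rho> 0 s" for \<rho> s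
      by (cases s) (simp add: translate_def)
    have "translate \<tau> 0 (translate (inv_into UNIV \<tau>) 0 st) = st"
      unfolding translate_translate permutes_inv_o[OF conjugation(3)] by (simp add: translate_def ipn)
    then have eq: "run x st = run y st"
      using * unfolding conjugation by (simp add: P)
    have "run y st \<in> states" using conjugation st
      by (simp add: step_in_states permutes_in_image)
    then show ?thesis unfolding eq by (rule symmetric_refl)
  next
    case (square k l)
    then have "quiver i (position p k) (position p l) = 0" using ent by simp
    then show ?thesis
      using move[of "[position p k, position p l]" "[position p l, position p k]"] pos square
        all_quivers_and_vertex_pairs[OF square_check i, of "position p k" "position p l"] by simp
  next
    case (pentagon k l)
    let ?k = "position p k" and ?l = "position p l" and ?\<tau> = "transpose (position p k) (position p l)"
    have "quiver i ?k ?l = 1 \<or> quiver i ?k ?l = - 1" using pentagon ent by simp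
    then have *: "symmetric False (run (map Mut [?k, ?l, ?k, ?l, ?k]) (start i)) (run [Perm ?\<tau>] (start i))"
      using pos pentagon all_quivers_and_vertex_pairs[OF pentagon_check i, of ?k ?l] by simp
    have "transpose (?\<sigma> a) (?\<sigma> b) \<circ> ?\<sigma> = ?\<sigma> \<circ> transpose a b" for a b
      using permutes_inj[OF \<sigma>] by (auto simp: fun_eq_iff transpose_def inj_eq)
    from this[of ?k ?l] have "transpose k l \<circ> ?\<sigma> = ?\<sigma> \<circ> ?\<tau>"
      using pos pentagon by simp
    then have "translate ?\<sigma> n (run [Perm ?\<tau>] (start i)) = run [Perm (transpose k l)] st"
      by (simp add: st' start_def translate_def comp_def fun_eq_iff)
    moreover have ks: "set [?k, ?l, ?k, ?l, ?k] \<subseteq> X6_vertices" using pos pentagon by simp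
    ultimately show ?thesis
      using symmetric_translate[OF * run_in_states[OF w[OF ks] si] \<sigma>, of n] run_translate[OF ks \<sigma> si, of n]
        pos pentagon by (simp add: st')
  qed
qed

section \<open>The winding of a loop\<close>

lemma X6_eq_1: "X6 a b = 1 \<longleftrightarrow> (a, b) \<in> {(1, 2), (3, 1), (1, 4), (5, 1), (1, 6)}"
  and X6_eq_2: "X6 a b = 2 \<longleftrightarrow> (a, b) \<in> {(2, 3), (4, 5)}"
proof -
  have *: "\<forall>a\<in>set [1..<7]. \<forall>b\<in>set [1..<7].
      (X6 a b = 1 \<longleftrightarrow> (a, b) \<in> {(1, 2), (3, 1), (1, 4), (5, 1), (1, 6)}) \<and>
      (X6 a b = 2 \<longleftrightarrow> (a, b) \<in> {(2, 3), (4, 5)})"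
    by code_simp
  have "(X6 a b = 1 \<longleftrightarrow> (a, b) \<in> {(1, 2), (3, 1), (1, 4), (5, 1), (1, 6)}) \<and>
      (X6 a b = 2 \<longleftrightarrow> (a, b) \<in> {(2, 3), (4, 5)})"
  proof (cases "a \<in> X6_vertices \<and> b \<in> X6_vertices")
    case True
    then show ?thesis using * unfolding X6_vertices_set by blast
  next
    case False
    then have "X6 a b = 0" using exchange_matrix_X6 unfolding exchange_matrix_def by blast
    then show ?thesis using False by (auto simp: X6_vertices_def)
  qed
  then show "X6 a b = 1 \<longleftrightarrow> (a, b) \<in> {(1, 2), (3, 1), (1, 4), (5, 1), (1, 6)}"
    "X6 a b = 2 \<longleftrightarrow> (a, b) \<in> {(2, 3), (4, 5)}" by blast+
qed

text \<open>
  \<open>X\<^sub>6\<close> is recognised by its double arrows \<open>2 \<rightarrow> 3\<close> and \<open>4 \<rightarrow> 5\<close>: \<open>Q\<^sub>1\<close>, \<open>Q\<^sub>3\<close> and \<open>Q\<^sub>4\<close> have none, and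
  in \<open>Q\<^sub>2\<close> the arrow between \<open>1\<close> and \<open>6\<close> points the other way. An automorphism permutes the two double
  arrows, and this determines it.
\<close>

lemma state_matrix_eq_X6:
  assumes "(i, p, n) \<in> states" "state_matrix (i, p, n) = X6"
  shows "i = 0" "p = ident \<or> p = reflection"
proof -
  have i: "i < 5" and p: "p \<in> arrangements" using assms(1) by (simp_all add: states_def)
  have \<sigma>: "perm_of p permutes X6_vertices" using p by (rule perm_of_permutes)
  have eq: "X6 (perm_of p a) (perm_of p b) = quiver i a b" for a b
    using assms(2) permutes_inverses(2)[OF \<sigma>]
    by (simp add: permute_matrix_def fun_eq_iff) metis
  obtain a b c d e f where abc: "p = [a, b, c, d, e, f]"
    using arrangement_length[OF p] by (auto simp: numeral_eq_Suc length_Suc_conv)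
  have dist: "distinct [a, b, c, d, e, f]" using p by (simp add: abc arrangements_def)
  \<comment> \<open>No double arrows in these three quivers.\<close>
  have small: "\<forall>i\<in>{1, 3, 4}. \<forall>a\<in>set [1..<7]. \<forall>b\<in>set [1..<7]. quiver i a b \<noteq> 2"
    by code_simp
  have "quiver i (position p 2) (position p 3) = 2"
    using eq[of "position p 2" "position p 3"] X6_eq_2[of 2 3]
      perm_of_position[OF p, of 2] perm_of_position[OF p, of 3] by (simp add: X6_vertices_def)
  then have "i \<notin> {1, 3, 4}"
    using small perm_of_position(1)[OF p, of 2] perm_of_position(1)[OF p, of 3]
    unfolding X6_vertices_set[symmetric] by (auto simp: X6_vertices_def)
  then have i02: "i = 0 \<or> i = 2" using i by auto
  note q = quiver_def quiver_rows_def table_matrix_def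
  have "X6 b c = 2" "X6 d e = 2" "X6 a b = 1"
    using eq[of 2 3] eq[of 4 5] eq[of 1 2] i02 by (auto simp: abc perm_of_def q)
  then have *: "a = 1" "(b, c, d, e) = (2, 3, 4, 5) \<or> (b, c, d, e) = (4, 5, 2, 3)"
    using dist unfolding X6_eq_1 X6_eq_2 by auto
  show "i = 0"
  proof (rule ccontr)
    assume "i \<noteq> 0"
    then have "X6 f a = 1" using eq[of 6 1] i02 by (auto simp: abc perm_of_def q)
    then show False using * dist unfolding X6_eq_1 by auto
  qed
  then have "X6 a f = 1" using eq[of 1 6] by (auto simp: abc perm_of_def q)
  then show "p = ident \<or> p = reflection"
    using * dist unfolding X6_eq_1 ident_def reflection_def abc by auto
qed

definition winding :: "nat word \<Rightarrow> int \<times> int" where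
  "winding w = (case run w (start 0) of (i, p, n) \<Rightarrow> (n, if p = ident then 0 else 1))"

lemma loop_state:
  assumes "w \<in> mutation_loops X6_vertices X6"
  obtains p n where "run w (start 0) = (0, p, n)" "p = ident \<or> p = reflection"
proof -
  obtain i p n where r: "run w (start 0) = (i, p, n)" by (metis prod_cases3)
  have w: "w \<in> words X6_vertices" "apply_word w X6 = X6" using assms by (simp_all add: mutation_loops_def)
  have s: "start 0 \<in> states" by (simp add: start_in_states)
  have "(i, p, n) \<in> states" "state_matrix (i, p, n) = X6"
    using run_in_states[OF w(1) s] state_matrix_run[OF w(1) s] w(2) unfolding r
    by (simp_all add: quiver_0 del: state_matrix.simps)
  then show thesis using state_matrix_eq_X6[of i p n] r that by blast
qed

lemma winding_loop_equiv:
  assumes "(w, w') \<in> loop_equiv X6_vertices X6"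
  shows "winding w = winding w'"
proof -
  let ?L = "mutation_loops X6_vertices X6"
  have move: "winding x = winding y" if xy: "x \<in> ?L" "y \<in> ?L" "elementary_move X6_vertices X6 x y" for x y
    using xy(3)
  proof cases
    case (1 u v x' y')
    have s: "start 0 \<in> states" by (simp add: start_in_states)
    have sv: "run v (start 0) \<in> states" using 1(4) s by (rule run_in_states)
    have "symmetric False (run x' (run v (start 0))) (run y' (run v (start 0)))"
      using 1 s sv by (intro run_elementary_relation) (simp_all add: state_matrix_run quiver_0)
    moreover have "x' \<in> words X6_vertices" using xy(1) 1 by (simp add: mutation_loops_def)
    ultimately have "symmetric False (run x (start 0)) (run y (start 0))"
      using 1 sv by (auto intro!: symmetric_run run_in_states)
    moreover obtain p n where "run x (start 0) = (0, p, n)" "p = ident \<or> p = reflection"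
      using loop_state[OF xy(1)] .
    ultimately show ?thesis
      by (cases "run y (start 0)") (auto simp: symmetries.simps winding_def ident_def reflection_def perm_of_def)
  qed
  have "equivclp (\<lambda>x y. x \<in> ?L \<and> y \<in> ?L \<and> elementary_move X6_vertices X6 x y) w w'"
    using assms by (simp add: loop_equiv_iff)
  then show ?thesis
    by (induction rule: equivclp_induct) (use move in \<open>metis (no_types, lifting)\<close>)+
qed

lemma run_shift: "run w (translate id n st) = translate id n (run w st)"
proof (induction w)
  case (Cons l w)
  have "step l (translate id n s) = translate id n (step l s)" for s
    by (cases s; cases l) (auto simp: translate_def split: prod.split)
  then show ?case by (simp only: run_Cons Cons.IH)
qed simp

lemma reflection_arrangement [simp]: "reflection \<in> arrangements"
  by (auto simp: reflection_def arrangements_def X6_vertices_def)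

lemma reflection_not_ident [simp]: "reflection \<noteq> ident"
  by (simp add: reflection_def ident_def)

lemma reflection_reflection [simp]: "map (perm_of reflection) reflection = ident"
  by (simp add: reflection_def ident_def perm_of_def)

lemma symmetric_0:
  "symmetric m (0, p, n) (i, q, k) \<longleftrightarrow>
     i = 0 \<and> k = n \<and> q = map (perm_of p) (if m then reflection else ident)"
  by (cases m) (auto simp: symmetries.simps)

declare symmetric.simps [simp del]

text \<open>
  After \<open>v\<close> the state is \<open>(0, q, m)\<close>, which is \<open>start 0\<close> shifted by \<open>m\<close>, up to a symmetry whose parity
  is the second component of the winding of \<open>v\<close>. Running \<open>u\<close> preserves this symmetry.
\<close>

lemma winding_append:
  assumes "u \<in> mutation_loops X6_vertices X6" "v \<in> mutation_loops X6_vertices X6"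
  shows "winding (u @ v) =
    (fst (winding u) + fst (winding v), (snd (winding u) + snd (winding v)) mod 2)"
proof -
  obtain p n where u: "run u (start 0) = (0, p, n)" "p = ident \<or> p = reflection"
    using loop_state[OF assms(1)] .
  obtain q m where v: "run v (start 0) = (0, q, m)" "q = ident \<or> q = reflection"
    using loop_state[OF assms(2)] .
  obtain r k where uv: "run u (0, q, m) = (0, r, k)" "r = ident \<or> r = reflection"
    using loop_state[OF mutation_loops_append[OF assms], unfolded run_append v(1)] .
  have shift: "translate id m (0, s, l) = (0, s, l + m)" for s l
    by (simp add: translate_def)
  have "symmetric (q \<noteq> ident) (translate id m (start 0)) (0, q, m)"
    using v(2) by (auto simp: start_def shift symmetric_0)
  then have "symmetric (q \<noteq> ident) (run u (translate id m (start 0))) (run u (0, q, m))"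
    using assms(1) by (intro symmetric_run translate_in_states start_in_states)
      (simp_all add: mutation_loops_def permutes_id)
  then have "k = n + m" "r = map (perm_of p) (if q \<noteq> ident then reflection else ident)"
    unfolding run_shift u(1) uv(1) shift symmetric_0 by simp_all
  then show ?thesis
    using u(2) v(2) by (auto simp: winding_def u(1) v(1) uv(1))
qed

section \<open>Equivalence of words that need not be loops\<close>

text \<open>
  Computing with classes of loops means rewriting pieces of words which are not loops themselves, so
  the equivalence is needed for words with the same source and target. It restricts to the given
  equivalence on loops (\<open>word_equiv_loop\<close>).
\<close>

definition word_equiv :: "'a set \<Rightarrow> 'a matrix \<Rightarrow> 'a word \<Rightarrow> 'a word \<Rightarrow> bool" where
  "word_equiv I \<epsilon> = equivclp (\<lambda>x y. x \<in> words I \<and> y \<in> words I \<and>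
     apply_word x \<epsilon> = apply_word y \<epsilon> \<and> elementary_move I \<epsilon> x y)"

lemma word_equiv_refl [simp]: "word_equiv I \<epsilon> x x"
  by (simp add: word_equiv_def)

lemma word_equiv_sym: "word_equiv I \<epsilon> x y \<Longrightarrow> word_equiv I \<epsilon> y x"
  unfolding word_equiv_def by (rule equivclp_sym)

lemma word_equiv_trans [trans]: "word_equiv I \<epsilon> x y \<Longrightarrow> word_equiv I \<epsilon> y z \<Longrightarrow> word_equiv I \<epsilon> x z"
  unfolding word_equiv_def by (rule equivclp_trans)

lemma word_equiv_context:
  assumes "word_equiv I (apply_word v \<epsilon>) x y" "u \<in> words I" "v \<in> words I"
  shows "word_equiv I \<epsilon> (u @ x @ v) (u @ y @ v)"
  using assms(1) unfolding word_equiv_def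
proof (induction rule: equivclp_induct)
  case (step y z)
  have "elementary_move I \<epsilon> (u @ a @ v) (u @ b @ v)"
    if "elementary_move I (apply_word v \<epsilon>) a b" for a b
    using that
  proof cases
    case (1 u' v' x' y')
    have "elementary_move I \<epsilon> ((u @ u') @ x' @ (v' @ v)) ((u @ u') @ y' @ (v' @ v))"
      by (rule elementary_move.intros) (use 1 assms in auto)
    then show ?thesis by (simp add: 1)
  qed
  then show ?case
    using step assms(2,3) by (auto intro: equivclp_into_equivclp)
qed simp

lemma word_equiv_relation:
  assumes "elementary_relation I \<epsilon> x y" "x \<in> words I" "y \<in> words I"
    "apply_word x \<epsilon> = apply_word y \<epsilon>"
  shows "word_equiv I \<epsilon> x y"
  using elementary_move.intros[of "[]" I "[]" \<epsilon> x y] assms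
  unfolding word_equiv_def by (auto intro!: r_into_equivclp)

lemma word_equiv_loop:
  assumes "word_equiv I \<epsilon> x y" "x \<in> mutation_loops I \<epsilon>"
  shows "(x, y) \<in> loop_equiv I \<epsilon>"
proof -
  let ?r = "\<lambda>x y. x \<in> mutation_loops I \<epsilon> \<and> y \<in> mutation_loops I \<epsilon> \<and> elementary_move I \<epsilon> x y"
  have "equivclp ?r x y \<and> y \<in> mutation_loops I \<epsilon>"
    using assms(1) unfolding word_equiv_def
  proof (induction rule: equivclp_induct)
    case (step y z)
    then have "z \<in> mutation_loops I \<epsilon>" "?r y z \<or> ?r z y"
      by (auto simp: mutation_loops_def)
    with step show ?case by (blast intro: equivclp_into_equivclp)
  qed (use assms(2) in simp)
  then show ?thesis using assms(2) by (simp add: loop_equiv_iff)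
qed

lemma permute_matrix_id [simp]: "permute_matrix id \<epsilon> = \<epsilon>"
  by (simp add: permute_matrix_def)

lemma word_equiv_Perm_comp:
  assumes "\<sigma> permutes I" "\<tau> permutes I"
  shows "word_equiv I \<epsilon> [Perm \<sigma>, Perm \<tau>] [Perm (\<sigma> \<circ> \<tau>)]"
  using assms words_Cons[of "Perm \<sigma>" "[Perm \<tau>]" I]
  by (intro word_equiv_relation elementary_relation.perm_comp)
     (auto simp: permute_matrix_comp permutes_compose)

lemma word_equiv_Perm_id:
  "word_equiv I \<epsilon> [Perm id] []"
  by (intro word_equiv_relation elementary_relation.perm_id) (auto simp: permutes_id)

lemma word_equiv_Mut_Mut:
  assumes "k \<in> I"
  shows "word_equiv I \<epsilon> [Mut k, Mut k] []"
  using assms words_Cons[of "Mut k" "[Mut k]" I]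
  by (intro word_equiv_relation elementary_relation.involution) (auto simp: mutate_mutate)

lemma word_equiv_Mut_Perm:
  assumes "k \<in> I" "\<sigma> permutes I"
  shows "word_equiv I \<epsilon> [Mut (\<sigma> k), Perm \<sigma>] [Perm \<sigma>, Mut k]"
proof -
  let ?i = "inv_into UNIV \<sigma>"
  have i: "?i permutes I" using assms(2) by (rule permutes_inv)
  have w: "[Perm \<sigma>] @ [Mut k] @ [Perm ?i] \<in> words I" "[Mut (\<sigma> k)] \<in> words I"
    using assms i permutes_in_image[OF assms(2)] unfolding words_append by simp_all
  have "word_equiv I \<epsilon>' [Perm \<sigma>, Mut k, Perm ?i] [Mut (\<sigma> k)]" for \<epsilon>'
  proof (rule word_equiv_relation[OF elementary_relation.conjugation])
    have "mutate (\<sigma> k) (permute_matrix \<sigma> (permute_matrix ?i \<epsilon>')) =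
        permute_matrix \<sigma> (mutate k (permute_matrix ?i \<epsilon>'))"
      by (rule mutate_permute_matrix) (rule permutes_bij[OF assms(2)])
    then show "apply_word [Perm \<sigma>, Mut k, Perm ?i] \<epsilon>' = apply_word [Mut (\<sigma> k)] \<epsilon>'"
      by (simp add: permute_matrix_comp[OF assms(2) i] permutes_inv_o[OF assms(2)])
  qed (use assms w in simp_all)
  from word_equiv_context[OF this, of "[]" "[Perm \<sigma>]" \<epsilon>] assms(2)
  have "word_equiv I \<epsilon> [Perm \<sigma>, Mut k, Perm ?i, Perm \<sigma>] [Mut (\<sigma> k), Perm \<sigma>]"
    by simp
  moreover have "word_equiv I \<epsilon> [Perm ?i, Perm \<sigma>] []"
    using word_equiv_Perm_comp[OF i assms(2), of \<epsilon>] word_equiv_Perm_id[of I \<epsilon>]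
    by (simp add: permutes_inv_o[OF assms(2)] word_equiv_trans)
  with word_equiv_context[of I "[]" \<epsilon> "[Perm ?i, Perm \<sigma>]" "[]" "[Perm \<sigma>, Mut k]"]
  have "word_equiv I \<epsilon> [Perm \<sigma>, Mut k, Perm ?i, Perm \<sigma>] [Perm \<sigma>, Mut k]"
    using assms words_Cons[of "Perm \<sigma>" "[Mut k]" I] by simp
  ultimately show ?thesis by (blast intro: word_equiv_trans word_equiv_sym)
qed

lemma word_equiv_inverse:
  assumes "w \<in> words I"
  shows "word_equiv I \<epsilon> (inverse_word w @ w) []"
  using assms
proof (induction w)
  case (Cons l w)
  have l: "[l] \<in> words I" and w: "w \<in> words I" using Cons.prems words_Cons[of l w] by simp_all
  have "word_equiv I \<epsilon>' [inverse_letter l, l] []" for \<epsilon>'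
  proof (cases l)
    case (Mut k)
    then show ?thesis using l by (simp add: word_equiv_Mut_Mut)
  next
    case (Perm \<sigma>)
    then have \<sigma>: "\<sigma> permutes I" using l by simp
    show ?thesis
      using word_equiv_Perm_comp[OF permutes_inv[OF \<sigma>] \<sigma>, of \<epsilon>'] word_equiv_Perm_id[of I \<epsilon>']
      by (simp add: Perm permutes_inv_o[OF \<sigma>] word_equiv_trans)
  qed
  from word_equiv_context[OF this inverse_word_in_words[OF w] w]
  show ?case using Cons.IH[OF w] by (auto intro: word_equiv_trans)
qed simp

lemma inverse_word_inverse_word:
  "w \<in> words I \<Longrightarrow> inverse_word (inverse_word w) = w"
proof (induction w)
  case (Cons l w)
  have append: "inverse_word (u @ v) = inverse_word v @ inverse_word u" for u v :: "'a word"
    by (simp add: inverse_word_def)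
  have "[l] \<in> words I" "w \<in> words I" using Cons.prems words_Cons[of l w] by simp_all
  then show ?case using Cons.IH
    by (cases l) (simp_all add: append permutes_inv_inv)
qed simp

lemma word_equiv_inverse':
  assumes "w \<in> words I"
  shows "word_equiv I \<epsilon> (w @ inverse_word w) []"
  using word_equiv_inverse[OF inverse_word_in_words[OF assms]]
  by (simp add: inverse_word_inverse_word[OF assms])

section \<open>The first homology group\<close>

abbreviation H1 :: "nat word set set monoid" where
  "H1 \<equiv> abelianization Gamma_X6"

interpretation H1: comm_group H1
  unfolding abelianization_def
  by (rule group.derived_quot_is_comm_group[OF group_Gamma_X6])

definition h1_class :: "nat word \<Rightarrow> nat word set set" where
  "h1_class w = ab_class Gamma_X6 (loop_class X6_vertices X6 w)"

abbreviation loops :: "nat word set" where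
  "loops \<equiv> mutation_loops X6_vertices X6"

lemma ab_class_hom: "ab_class Gamma_X6 \<in> hom Gamma_X6 H1"
  unfolding abelianization_def ab_class_def[abs_def]
  by (rule normal.r_coset_hom_Mod[OF group.derived_self_is_normal[OF group_Gamma_X6]])

lemma loop_class_carrier: "w \<in> loops \<Longrightarrow> loop_class X6_vertices X6 w \<in> carrier Gamma_X6"
  by (simp add: Gamma_X6_def carrier_saturated_modular_group)

lemma h1_class_closed [simp]: "w \<in> loops \<Longrightarrow> h1_class w \<in> carrier H1"
  using hom_in_carrier[OF ab_class_hom loop_class_carrier] by (simp add: h1_class_def)

lemma h1_class_append: "u \<in> loops \<Longrightarrow> v \<in> loops \<Longrightarrow> h1_class (u @ v) = h1_class u \<otimes>\<^bsub>H1\<^esub> h1_class v"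
  using hom_mult[OF ab_class_hom loop_class_carrier loop_class_carrier, of u v]
  by (simp add: h1_class_def Gamma_X6_def mult_loop_class)

lemma h1_class_cong:
  assumes "word_equiv X6_vertices X6 u v" "u \<in> loops"
  shows "h1_class u = h1_class v"
  using word_equiv_loop[OF assms] unfolding h1_class_def loop_class_def
  by (simp add: equiv_class_eq[OF equiv_loop_equiv])

lemma Nil_loop [simp]: "[] \<in> loops"
  by (simp add: mutation_loops_def)

lemma h1_class_Nil [simp]: "h1_class [] = \<one>\<^bsub>H1\<^esub>"
  using h1_class_append[of "[]" "[]"] H1.l_cancel_one'[of "h1_class []" "h1_class []"] by simp

lemma h1_class_inverse: "w \<in> loops \<Longrightarrow> h1_class (inverse_word w) = inv\<^bsub>H1\<^esub> h1_class w"
  using h1_class_append[OF inverse_word_loop, of w w] h1_class_cong[OF word_equiv_inverse, of w]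
    inverse_word_loop[of w] mutation_loops_append[OF inverse_word_loop, of w _ _ w]
  by (intro H1.inv_equality[symmetric]) (auto simp: mutation_loops_def)

section \<open>Holonomy and defects\<close>

text \<open>
  Paths from \<open>X\<^sub>6\<close> to the \<open>Q\<^sub>i\<close> along the tree on which the weights vanish.
\<close>

definition base :: "nat \<Rightarrow> nat word" where
  "base i = [[], [Mut 1], [Mut 6], [Mut 1, Mut 6], [Mut 6, Mut 1]] ! i"

lemma base_words: "i < 5 \<Longrightarrow> base i \<in> words X6_vertices"
  by (auto simp: base_def words_def X6_vertices_def less_Suc_eq numeral_eq_Suc)

lemma run_base: "i < 5 \<Longrightarrow> run (base i) (start 0) = start i"
proof -
  have "\<forall>i\<in>set [0..<5]. run (base i) (start 0) = start i" by code_simp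
  then show "i < 5 \<Longrightarrow> run (base i) (start 0) = start i" by simp
qed

lemma apply_base: "i < 5 \<Longrightarrow> apply_word (base i) X6 = quiver i"
  using state_matrix_run[OF base_words start_in_states, of i 0]
  by (simp add: run_base quiver_0)

text \<open>
  \<open>w\<close> leads from \<open>X\<^sub>6\<close> to the matrix of \<open>st\<close>. The state need not be the one obtained by running \<open>w\<close>:
  the comparison of different states with the same matrix is what produces relations.
\<close>

definition tracked :: "nat word \<Rightarrow> state \<Rightarrow> bool" where
  "tracked w st \<longleftrightarrow> w \<in> words X6_vertices \<and> st \<in> states \<and> apply_word w X6 = state_matrix st"

text \<open>
  The word \<open>w\<close> is closed up by the standard path to the matrix of the state, and the expected class
  \<open>\<alpha>\<^sub>1\<^sup>n\<close> is divided out.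
\<close>

fun holonomy :: "nat word \<Rightarrow> state \<Rightarrow> nat word set set" where
  "holonomy w (i, p, n) =
     h1_class (inverse_word (Perm (perm_of p) # base i) @ w) \<otimes>\<^bsub>H1\<^esub> h1_class alpha1_word [^]\<^bsub>H1\<^esub> (- n)"

lemma tracked_canonical:
  "(i, p, n) \<in> states \<Longrightarrow> tracked (Perm (perm_of p) # base i) (i, p, n)"
  using words_Cons[of "Perm (perm_of p)" "base i" X6_vertices]
  by (simp add: tracked_def states_def base_words apply_base perm_of_permutes)

lemma same_target_loop:
  assumes "u \<in> words X6_vertices" "v \<in> words X6_vertices" "apply_word u X6 = apply_word v X6"
  shows "inverse_word u @ v \<in> loops"
  using assms apply_inverse_word[OF assms(1), of X6] inverse_word_in_words
  by (simp add: mutation_loops_def)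

lemma tracked_loop:
  assumes "tracked w (i, p, n)"
  shows "inverse_word (Perm (perm_of p) # base i) @ w \<in> loops"
  using assms tracked_canonical[of i p n]
  by (intro same_target_loop) (auto simp: tracked_def simp del: state_matrix.simps)

lemma alpha1_pow_closed [simp]: "h1_class alpha1_word [^]\<^bsub>H1\<^esub> (n::int) \<in> carrier H1"
  by (simp add: alpha1_loop)

lemma holonomy_closed [simp]: "tracked w st \<Longrightarrow> holonomy w st \<in> carrier H1"
  by (cases st) (simp add: tracked_loop[simplified])

lemma holonomy_cong:
  assumes "word_equiv X6_vertices X6 u v" "tracked u st"
  shows "holonomy u st = holonomy v st"
proof -
  obtain i p n where st: "st = (i, p, n)" by (metis prod_cases3)
  let ?c = "inverse_word (Perm (perm_of p) # base i)"
  have "?c \<in> words X6_vertices"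
    using tracked_canonical[of i p n] assms(2) by (intro inverse_word_in_words) (simp add: st tracked_def)
  then have "word_equiv X6_vertices X6 (?c @ u) (?c @ v)"
    using word_equiv_context[of X6_vertices "[]" X6 u v ?c] assms(1) by simp
  then have "h1_class (?c @ u) = h1_class (?c @ v)"
    using tracked_loop[OF assms(2)[unfolded st]] by (rule h1_class_cong)
  then show ?thesis by (simp add: st)
qed

lemma tracked_step:
  assumes "tracked w st" "[l] \<in> words X6_vertices"
  shows "tracked (l # w) (step l st)"
  using assms words_Cons[of l w X6_vertices] by (simp add: tracked_def step_in_states state_matrix_step)

lemma holonomy_Perm:
  assumes "tracked w st" "\<sigma> permutes X6_vertices"
  shows "holonomy (Perm \<sigma> # w) (step (Perm \<sigma>) st) = holonomy w st"
proof -
  obtain i p n where st: "st = (i, p, n)" by (metis prod_cases3)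
  have i: "i < 5" and p: "p \<in> arrangements" and w: "w \<in> words X6_vertices"
    using assms(1) by (simp_all add: st tracked_def states_def)
  let ?b = "inverse_word (base i)" and ?p = "inv_into UNIV (perm_of p)"
    and ?q = "inv_into UNIV (\<sigma> \<circ> perm_of p)"
  have \<pi>: "perm_of p permutes X6_vertices" using p by (rule perm_of_permutes)
  have q: "?q permutes X6_vertices"
    using \<pi> assms(2) by (intro permutes_inv permutes_compose)
  have "?q \<circ> \<sigma> = ?p \<circ> (inv_into UNIV \<sigma> \<circ> \<sigma>)"
    by (simp add: o_inv_distrib permutes_bij[OF \<pi>] permutes_bij[OF assms(2)] comp_assoc)
  then have "?q \<circ> \<sigma> = ?p" by (simp add: permutes_inv_o[OF assms(2)])
  then have "word_equiv X6_vertices (apply_word w X6) [Perm ?q, Perm \<sigma>] [Perm ?p]"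
    using word_equiv_Perm_comp[OF q assms(2)] by simp
  from word_equiv_context[OF this inverse_word_in_words[OF base_words[OF i]] w]
  have "word_equiv X6_vertices X6 (?b @ [Perm ?q, Perm \<sigma>] @ w) (?b @ [Perm ?p] @ w)" .
  moreover have "?b @ [Perm ?q, Perm \<sigma>] @ w \<in> loops"
    using tracked_loop[of "Perm \<sigma> # w" i "map \<sigma> p" n] tracked_step[OF assms(1), of "Perm \<sigma>"] assms(2)
    by (simp add: st perm_of_map[OF p assms(2)])
  ultimately have "h1_class (?b @ [Perm ?q, Perm \<sigma>] @ w) = h1_class (?b @ [Perm ?p] @ w)"
    by (rule h1_class_cong)
  then show ?thesis by (simp add: st perm_of_map[OF p assms(2)])
qed

definition defect :: "nat \<Rightarrow> nat \<Rightarrow> nat word set set" where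
  "defect i k = holonomy (Mut k # base i) (edge i k)"

lemma tracked_base: "i < 5 \<Longrightarrow> tracked (base i) (start i)"
  by (simp add: tracked_def base_words start_in_states apply_base)

lemma tracked_edge: "i < 5 \<Longrightarrow> k \<in> X6_vertices \<Longrightarrow> tracked (Mut k # base i) (edge i k)"
  using words_Cons[of "Mut k" "base i" X6_vertices]
  by (simp add: tracked_def base_words edge_in_states apply_base mutate_quiver)

lemma defect_closed [simp]: "i < 5 \<Longrightarrow> k \<in> X6_vertices \<Longrightarrow> defect i k \<in> carrier H1"
  by (simp add: defect_def tracked_edge)

text \<open>
  With \<open>\<pi>\<close> the relabelling of the state, \<open>\<mu>\<^sub>k = \<pi> \<mu>\<^bsub>k'\<^esub> \<pi>\<inverse>\<close> at \<open>\<pi> Q\<^sub>i\<close>. Inserting the path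
  to \<open>Q\<^sub>i\<close> and back splits the closed up word into the loop of the edge at \<open>k'\<close> and the closed up
  word \<open>w\<close>.
\<close>

lemma holonomy_Mut:
  assumes "tracked w (i, p, n)" "k \<in> X6_vertices"
  shows "holonomy (Mut k # w) (step (Mut k) (i, p, n)) = defect i (position p k) \<otimes>\<^bsub>H1\<^esub> holonomy w (i, p, n)"
proof -
  let ?\<pi> = "perm_of p" and ?k = "position p k"
  have i: "i < 5" and p: "p \<in> arrangements" and w: "w \<in> words X6_vertices"
    and wm: "apply_word w X6 = permute_matrix ?\<pi> (quiver i)"
    using assms(1) by (simp_all add: tracked_def states_def)
  have \<pi>: "?\<pi> permutes X6_vertices" using p by (rule perm_of_permutes)
  have k: "?k \<in> X6_vertices" "?\<pi> ?k = k" using perm_of_position[OF p assms(2)] .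
  obtain j t f where e: "edge i ?k = (j, t, f)" by (metis prod_cases3)
  have j: "j < 5" and t: "t \<in> arrangements" using edge_in_states[OF i k(1)] by (simp_all add: e states_def)
  have \<tau>: "perm_of t permutes X6_vertices" using t by (rule perm_of_permutes)
  let ?bi = "base i" and ?Bi = "inverse_word (base i)" and ?Bj = "inverse_word (base j)"
    and ?T = "inv_into UNIV (perm_of t)" and ?P = "inv_into UNIV ?\<pi>"
  have st: "step (Mut k) (i, p, n) = (j, map ?\<pi> t, n + f)"
    by (simp add: e translate_def)
  have T: "?T permutes X6_vertices" and P: "?P permutes X6_vertices"
    using \<tau> \<pi> by (simp_all add: permutes_inv)
  have words: "?bi \<in> words X6_vertices" "?Bi \<in> words X6_vertices" "?Bj \<in> words X6_vertices"
    using i j by (simp_all add: base_words inverse_word_in_words)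
  let ?u = "?Bj @ [Perm ?T, Mut ?k]" and ?v = "[Perm ?P] @ w"
  have l1: "inverse_word (Perm (perm_of t) # base j) @ (Mut ?k # ?bi) \<in> loops"
    using tracked_edge[OF i k(1)] unfolding e by (rule tracked_loop)
  have l2: "inverse_word (Perm ?\<pi> # ?bi) @ w \<in> loops"
    using assms(1) by (rule tracked_loop)
  have loop: "?u @ (?bi @ ?Bi) @ ?v \<in> loops"
    using mutation_loops_append[OF l1 l2] by simp
  have uw: "?u \<in> words X6_vertices" and vw: "?v \<in> words X6_vertices"
    using words w T P k(1) words_Cons[of "Perm ?T" "[Mut ?k]"] words_Cons[of "Perm ?P" w] by simp_all
  have "word_equiv X6_vertices X6 (?u @ (?bi @ ?Bi) @ ?v) (?u @ [] @ ?v)"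
    by (rule word_equiv_context[OF word_equiv_inverse'[OF words(1)] uw vw])
  also have "word_equiv X6_vertices X6 (?u @ [] @ ?v) (?Bj @ [Perm (inv_into UNIV (?\<pi> \<circ> perm_of t)), Mut k] @ w)"
  proof -
    have Pk: "?P k = ?k" using k(2) permutes_inverses(2)[OF \<pi>, of ?k] by simp
    have "word_equiv X6_vertices (apply_word w X6) [Mut ?k, Perm ?P] [Perm ?P, Mut k]"
      using word_equiv_Mut_Perm[OF assms(2) P] by (simp only: Pk)
    from word_equiv_context[OF this _ w, of "?Bj @ [Perm ?T]"] words(3) T
    have 1: "word_equiv X6_vertices X6 (?u @ [] @ ?v) (?Bj @ [Perm ?T, Perm ?P, Mut k] @ w)"
      by simp
    have "?T \<circ> ?P = inv_into UNIV (?\<pi> \<circ> perm_of t)"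
      by (simp add: o_inv_distrib permutes_bij[OF \<pi>] permutes_bij[OF \<tau>])
    then have "word_equiv X6_vertices (apply_word (Mut k # w) X6) [Perm ?T, Perm ?P]
        [Perm (inv_into UNIV (?\<pi> \<circ> perm_of t))]"
      using word_equiv_Perm_comp[OF T P] by simp
    from word_equiv_context[OF this words(3)] w assms(2) words_Cons[of "Mut k" w X6_vertices]
    have "word_equiv X6_vertices X6 (?Bj @ [Perm ?T, Perm ?P, Mut k] @ w)
        (?Bj @ [Perm (inv_into UNIV (?\<pi> \<circ> perm_of t)), Mut k] @ w)" by simp
    with 1 show ?thesis by (rule word_equiv_trans)
  qed
  finally have "h1_class (?u @ (?bi @ ?Bi) @ ?v) = h1_class (?Bj @ [Perm (inv_into UNIV (?\<pi> \<circ> perm_of t)), Mut k] @ w)"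
    using loop by (rule h1_class_cong)
  moreover have "h1_class (?u @ (?bi @ ?Bi) @ ?v) =
      h1_class (inverse_word (Perm (perm_of t) # base j) @ (Mut ?k # ?bi)) \<otimes>\<^bsub>H1\<^esub> h1_class (inverse_word (Perm ?\<pi> # ?bi) @ w)"
    using h1_class_append[OF l1 l2] by simp
  moreover have "h1_class alpha1_word [^]\<^bsub>H1\<^esub> (- (n + f)) =
      h1_class alpha1_word [^]\<^bsub>H1\<^esub> (- f) \<otimes>\<^bsub>H1\<^esub> h1_class alpha1_word [^]\<^bsub>H1\<^esub> (- n)"
    using H1.int_pow_mult[of "h1_class alpha1_word" "- f" "- n"] by (simp add: alpha1_loop algebra_simps)
  ultimately show ?thesis
    unfolding st holonomy.simps defect_def e perm_of_map[OF t \<pi>]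
    using l1 l2 by (simp add: H1.m_ac)
qed

lemma holonomy_base: "i < 5 \<Longrightarrow> holonomy (base i) (start i) = \<one>\<^bsub>H1\<^esub>"
proof -
  assume i: "i < 5"
  have b: "base i \<in> words X6_vertices" using i by (rule base_words)
  have l: "inverse_word (Perm (perm_of ident) # base i) @ base i \<in> loops"
    using tracked_base[OF i] unfolding start_def by (rule tracked_loop)
  have "word_equiv X6_vertices X6 (inverse_word (base i) @ [Perm id] @ base i) (inverse_word (base i) @ [] @ base i)"
    by (rule word_equiv_context[OF word_equiv_Perm_id inverse_word_in_words[OF b] b])
  then have "word_equiv X6_vertices X6 (inverse_word (Perm (perm_of ident) # base i) @ base i) []"
    using word_equiv_inverse[OF b, of X6] by (simp add: word_equiv_trans)
  from h1_class_cong[OF this l] show ?thesis by (simp add: start_def)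
qed

text \<open>
  The edges along which a word runs; as in a word, the first edge comes last.
\<close>

fun trace :: "nat word \<Rightarrow> state \<Rightarrow> (nat \<times> nat) list" where
  "trace [] st = []"
| "trace (Mut k # w) st = (case run w st of (i, p, n) \<Rightarrow> (i, position p k)) # trace w st"
| "trace (Perm \<sigma> # w) st = trace w st"

fun defects :: "(nat \<times> nat) list \<Rightarrow> nat word set set" where
  "defects [] = \<one>\<^bsub>H1\<^esub>"
| "defects ((i, k) # es) = defect i k \<otimes>\<^bsub>H1\<^esub> defects es"

lemma trace_edges:
  assumes "w \<in> words X6_vertices" "st \<in> states"
  shows "set (trace w st) \<subseteq> {..<5} \<times> X6_vertices"
  using assms(1)
proof (induction w)
  case (Cons l w)
  have l: "[l] \<in> words X6_vertices" and w: "w \<in> words X6_vertices"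
    using Cons.prems words_Cons[of l w] by simp_all
  show ?case
    using Cons.IH[OF w] l run_in_states[OF w assms(2)] perm_of_position(1)
    by (cases l) (auto simp: states_def)
qed simp

lemma defects_closed:
  "set es \<subseteq> {..<5} \<times> X6_vertices \<Longrightarrow> defects es \<in> carrier H1"
  by (induction es rule: defects.induct) auto

lemma tracked_run:
  assumes "tracked w st" "u \<in> words X6_vertices"
  shows "tracked (u @ w) (run u st)"
  using assms(2)
proof (induction u)
  case (Cons l u)
  then show ?case using words_Cons[of l u X6_vertices] by (simp add: tracked_step)
qed (use assms in simp)

lemma holonomy_run:
  assumes "tracked w st" "u \<in> words X6_vertices"
  shows "holonomy (u @ w) (run u st) = defects (trace u st) \<otimes>\<^bsub>H1\<^esub> holonomy w st"
  using assms(2)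
proof (induction u)
  case (Cons l u)
  have l: "[l] \<in> words X6_vertices" and u: "u \<in> words X6_vertices"
    using Cons.prems words_Cons[of l u] by simp_all
  have st: "st \<in> states" using assms(1) by (simp add: tracked_def)
  have t: "tracked (u @ w) (run u st)" using assms(1) u by (rule tracked_run)
  show ?case
  proof (cases l)
    case (Mut k)
    obtain i p n where r: "run u st = (i, p, n)" by (metis prod_cases3)
    have k: "k \<in> X6_vertices" using l Mut by simp
    have "(i, p, n) \<in> states" using run_in_states[OF u st] r by simp
    then have "i < 5" "position p k \<in> X6_vertices"
      using perm_of_position(1) k by (auto simp: states_def)
    then show ?thesis
      using holonomy_Mut[OF t[unfolded r] k] Cons.IH[OF u] defects_closed[OF trace_edges[OF u st]] assms(1)
      by (simp add: Mut r H1.m_assoc del: step.simps holonomy.simps)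
  next
    case (Perm \<sigma>)
    then show ?thesis using holonomy_Perm[OF t] l Cons.IH[OF u] by simp
  qed
qed (use assms in simp)

section \<open>Classes of the automorphisms\<close>

definition symmetry_class :: "nat \<Rightarrow> nat list \<Rightarrow> nat word set set" where
  "symmetry_class i c = h1_class (inverse_word (base i) @ Perm (perm_of c) # base i)"

definition automorphism :: "nat \<Rightarrow> nat list \<Rightarrow> bool" where
  "automorphism i c \<longleftrightarrow> i < 5 \<and> c \<in> arrangements \<and> permute_matrix (perm_of c) (quiver i) = quiver i"

lemma symmetry_automorphism:
  assumes "i < 5" "(c, m) \<in> set (symmetries i)"
  shows "automorphism i c"
proof -
  have "\<forall>i\<in>set [0..<5]. \<forall>a\<in>set [1..<7]. \<forall>b\<in>set [1..<7]. \<forall>(c, m)\<in>set (symmetries i).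
      quiver i a b = quiver i (perm_of c a) (perm_of c b)"
    by code_simp
  from all_quivers_and_vertex_pairs[OF this assms(1)] assms(2)
  have "\<forall>a\<in>X6_vertices. \<forall>b\<in>X6_vertices. quiver i a b = quiver i (perm_of c a) (perm_of c b)"
    by blast
  moreover have "c \<in> arrangements" using assms(2) by (rule symmetries_arrangements)
  ultimately show ?thesis
    using permute_matrix_eqI[OF perm_of_permutes exchange_matrix_quiver exchange_matrix_quiver] assms(1)
    by (simp add: automorphism_def)
qed

lemma symmetry_loop:
  assumes "automorphism i c"
  shows "inverse_word (base i) @ Perm (perm_of c) # base i \<in> loops"
  using assms words_Cons[of "Perm (perm_of c)" "base i" X6_vertices]
  by (intro same_target_loop) (auto simp: automorphism_def base_words apply_base perm_of_permutes)

lemma symmetry_class_closed [simp]: "automorphism i c \<Longrightarrow> symmetry_class i c \<in> carrier H1"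
  by (simp add: symmetry_class_def symmetry_loop)

lemma symmetry_class_comp:
  assumes "automorphism i b" "automorphism i c"
  shows "symmetry_class i (map (perm_of b) c) = symmetry_class i b \<otimes>\<^bsub>H1\<^esub> symmetry_class i c"
proof -
  have i: "i < 5" and b: "perm_of b permutes X6_vertices" and c: "c \<in> arrangements"
    and c': "perm_of c permutes X6_vertices"
    using assms by (auto simp: automorphism_def perm_of_permutes)
  let ?b = "base i" and ?B = "inverse_word (base i)"
  have w: "?b \<in> words X6_vertices" "?B \<in> words X6_vertices"
    using i by (simp_all add: base_words inverse_word_in_words)
  have "word_equiv X6_vertices X6 ((?B @ [Perm (perm_of b)]) @ (?b @ ?B) @ (Perm (perm_of c) # ?b))
      ((?B @ [Perm (perm_of b)]) @ [] @ (Perm (perm_of c) # ?b))"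
    using w b c' words_Cons[of "Perm (perm_of c)" ?b X6_vertices]
    by (intro word_equiv_context word_equiv_inverse') simp_all
  also have "word_equiv X6_vertices X6 ((?B @ [Perm (perm_of b)]) @ [] @ (Perm (perm_of c) # ?b))
      (?B @ [Perm (perm_of b \<circ> perm_of c)] @ ?b)"
    using word_equiv_context[OF word_equiv_Perm_comp[OF b c'] w(2) w(1)] by simp
  finally have "h1_class ((?B @ [Perm (perm_of b)]) @ (?b @ ?B) @ (Perm (perm_of c) # ?b)) =
      h1_class (?B @ [Perm (perm_of b \<circ> perm_of c)] @ ?b)"
    using mutation_loops_append[OF symmetry_loop[OF assms(1)] symmetry_loop[OF assms(2)]]
    by (intro h1_class_cong) simp_all
  then show ?thesis
    using h1_class_append[OF symmetry_loop[OF assms(1)] symmetry_loop[OF assms(2)]]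
    by (simp add: symmetry_class_def perm_of_map[OF c b])
qed

lemma symmetry_class_ident: "i < 5 \<Longrightarrow> symmetry_class i ident = \<one>\<^bsub>H1\<^esub>"
proof -
  assume "i < 5"
  then have a: "automorphism i ident" by (simp add: automorphism_def)
  then have "symmetry_class i ident = symmetry_class i ident \<otimes>\<^bsub>H1\<^esub> symmetry_class i ident"
    using symmetry_class_comp[OF a a] by simp
  then show ?thesis using a by simp
qed

text \<open>
  A mutation at a vertex fixed by the automorphism commutes with it, so the automorphism has the same
  class at both ends of the edge. All edges of the tree are at the vertices \<open>1\<close> and \<open>6\<close>, which the
  reflection fixes.
\<close>

lemma symmetry_class_transfer:
  assumes "automorphism i c" "automorphism j c" "k \<in> X6_vertices" "perm_of c k = k"
    "base j = Mut k # base i"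
  shows "symmetry_class j c = symmetry_class i c"
proof -
  have i: "i < 5" and c: "perm_of c permutes X6_vertices"
    using assms(1) by (auto simp: automorphism_def perm_of_permutes)
  let ?b = "base i" and ?B = "inverse_word (base i)" and ?c = "Perm (perm_of c)"
  have w: "?b \<in> words X6_vertices" "?B \<in> words X6_vertices"
    using i by (simp_all add: base_words inverse_word_in_words)
  have 1: "word_equiv X6_vertices (quiver i) [Mut k, ?c, Mut k] [Mut k, Mut k, ?c]"
    using word_equiv_context[of X6_vertices "[]" "quiver i" "[?c, Mut k]" "[Mut k, ?c]" "[Mut k]"]
      word_equiv_sym[OF word_equiv_Mut_Perm[OF assms(3) c, of "quiver i"]] assms(3,4) by simp
  have 2: "word_equiv X6_vertices (quiver i) [Mut k, Mut k, ?c] [?c]"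
    using word_equiv_context[of X6_vertices "[?c]" "quiver i" "[Mut k, Mut k]" "[]" "[]"]
      word_equiv_Mut_Mut[OF assms(3)] c by simp
  have "word_equiv X6_vertices X6 (?B @ [Mut k, ?c, Mut k] @ ?b) (?B @ [?c] @ ?b)"
    using word_equiv_trans[OF 1 2] w by (intro word_equiv_context) (simp_all add: apply_base[OF i])
  then have "h1_class (?B @ [Mut k, ?c, Mut k] @ ?b) = h1_class (?B @ [?c] @ ?b)"
    using symmetry_loop[OF assms(2)] by (intro h1_class_cong) (simp_all add: assms(5))
  then show ?thesis by (simp add: symmetry_class_def assms(5))
qed

definition reflection_class :: "nat word set set" where
  "reflection_class = symmetry_class 0 reflection"

lemma reflection_automorphism [simp]: "i < 5 \<Longrightarrow> automorphism i reflection"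
  by (rule symmetry_automorphism[where m = True]) (simp_all add: symmetries.simps)

lemma reflection_class_closed [simp]: "reflection_class \<in> carrier H1"
  by (simp add: reflection_class_def)

lemma reflection_class_squared [simp]: "reflection_class \<otimes>\<^bsub>H1\<^esub> reflection_class = \<one>\<^bsub>H1\<^esub>"
  using symmetry_class_comp[of 0 reflection reflection] by (simp add: symmetry_class_ident reflection_class_def)

lemma inv_reflection_class [simp]: "inv\<^bsub>H1\<^esub> reflection_class = reflection_class"
  by (rule H1.inv_equality) simp_all

lemma symmetry_class_reflection:
  assumes "i < 5"
  shows "symmetry_class i reflection = reflection_class"
proof -
  have fixed: "perm_of reflection 1 = 1" "perm_of reflection 6 = 6" "(1::nat) \<in> X6_vertices" "(6::nat) \<in> X6_vertices"
    by (simp_all add: perm_of_def reflection_def X6_vertices_def)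
  have b: "base 1 = Mut 1 # base 0" "base 2 = Mut 6 # base 0" "base 3 = Mut 1 # base 2" "base 4 = Mut 6 # base 1"
    by (simp_all add: base_def)
  have "symmetry_class 1 reflection = reflection_class" "symmetry_class 2 reflection = reflection_class"
    using symmetry_class_transfer[OF _ _ fixed(3,1) b(1)] symmetry_class_transfer[OF _ _ fixed(4,2) b(2)]
    by (simp_all add: reflection_class_def)
  moreover have "symmetry_class 3 reflection = symmetry_class 2 reflection"
    "symmetry_class 4 reflection = symmetry_class 1 reflection"
    using symmetry_class_transfer[OF _ _ fixed(3,1) b(3)] symmetry_class_transfer[OF _ _ fixed(4,2) b(4)] by simp_all
  moreover have "i = 0 \<or> i = 1 \<or> i = 2 \<or> i = 3 \<or> i = 4" using assms by auto
  ultimately show ?thesis by (auto simp: reflection_class_def)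
qed

text \<open>
  A rotation of \<open>Q\<^sub>4\<close> is inverted by conjugation with the reflection, so it has the same class as its
  inverse, which is also its square, and this class is trivial.
\<close>

lemma symmetry_class_rotation:
  "symmetry_class 4 [3, 6, 5, 2, 1, 4] = \<one>\<^bsub>H1\<^esub>" "symmetry_class 4 [5, 4, 1, 6, 3, 2] = \<one>\<^bsub>H1\<^esub>"
  "symmetry_class 4 [3, 2, 1, 6, 5, 4] = reflection_class" "symmetry_class 4 [5, 6, 3, 4, 1, 2] = reflection_class"
proof -
  define r r' q q' :: "nat list"
    where "r = [3, 6, 5, 2, 1, 4]" and "r' = [5, 4, 1, 6, 3, 2]"
      and "q = [5, 6, 3, 4, 1, 2]" and "q' = [3, 2, 1, 6, 5, 4]"
  note defs = r_def r'_def q_def q'_def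
  have aut: "automorphism 4 r" "automorphism 4 r'"
    by (rule symmetry_automorphism[where m = False]; simp add: symmetries.simps defs)+
  have aut': "automorphism 4 q"
    by (rule symmetry_automorphism[where m = True]; simp add: symmetries.simps defs)
  have refl: "automorphism 4 reflection" "symmetry_class 4 reflection = reflection_class"
    using symmetry_class_reflection[of 4] by simp_all
  have comp: "map (perm_of r) r = r'" "map (perm_of reflection) r = q"
    "map (perm_of q) reflection = r'" "map (perm_of reflection) r' = q'"
    by (simp_all add: perm_of_def reflection_def defs)
  let ?r = "symmetry_class 4 r"
  have rr: "symmetry_class 4 r' = ?r \<otimes>\<^bsub>H1\<^esub> ?r"
    using symmetry_class_comp[OF aut(1) aut(1)] unfolding comp .
  have q: "symmetry_class 4 q = reflection_class \<otimes>\<^bsub>H1\<^esub> ?r"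
    using symmetry_class_comp[OF refl(1) aut(1)] unfolding comp refl .
  \<comment> \<open>The inverse rotation is a conjugate by the reflection.\<close>
  have "symmetry_class 4 r' = reflection_class \<otimes>\<^bsub>H1\<^esub> ?r \<otimes>\<^bsub>H1\<^esub> reflection_class"
    using symmetry_class_comp[OF aut' refl(1)] unfolding comp refl q .
  also have "\<dots> = ?r \<otimes>\<^bsub>H1\<^esub> (reflection_class \<otimes>\<^bsub>H1\<^esub> reflection_class)"
    using aut by (simp add: H1.m_ac del: reflection_class_squared)
  also have "\<dots> = ?r" using aut by simp
  finally have "?r \<otimes>\<^bsub>H1\<^esub> ?r = ?r" unfolding rr .
  then have r: "?r = \<one>\<^bsub>H1\<^esub>" using aut(1) by simp
  then have r': "symmetry_class 4 r' = \<one>\<^bsub>H1\<^esub>" using rr by simp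
  show "symmetry_class 4 [3, 6, 5, 2, 1, 4] = \<one>\<^bsub>H1\<^esub>" "symmetry_class 4 [5, 4, 1, 6, 3, 2] = \<one>\<^bsub>H1\<^esub>"
    using r r' unfolding defs .
  show "symmetry_class 4 [5, 6, 3, 4, 1, 2] = reflection_class" using q r unfolding defs by simp
  show "symmetry_class 4 [3, 2, 1, 6, 5, 4] = reflection_class"
    using symmetry_class_comp[OF refl(1) aut(2)] r' unfolding comp refl unfolding defs by simp
qed

lemma symmetry_class_eq:
  assumes "i < 5" "(c, m) \<in> set (symmetries i)"
  shows "symmetry_class i c = (if m then reflection_class else \<one>\<^bsub>H1\<^esub>)"
proof -
  have "(c, m) = (ident, False) \<or> (c, m) = (reflection, True) \<or>
      i = 4 \<and> (c, m) \<in> {([3, 6, 5, 2, 1, 4], False), ([5, 4, 1, 6, 3, 2], False),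
        ([3, 2, 1, 6, 5, 4], True), ([5, 6, 3, 4, 1, 2], True)}"
    using assms(2) by (auto simp: symmetries.simps split: if_splits)
  then show ?thesis
    using symmetry_class_ident[OF assms(1)] symmetry_class_reflection[OF assms(1)]
      symmetry_class_rotation by (elim disjE conjE insertE emptyE) simp_all
qed

text \<open>
  The two ways to close up \<open>w\<close> differ by an automorphism of \<open>Q\<^sub>i\<close>, transported to \<open>X\<^sub>6\<close> along the
  standard path.
\<close>

lemma holonomy_symmetric:
  assumes "symmetric m st st'" "tracked w st"
  shows "holonomy w st' = holonomy w st \<otimes>\<^bsub>H1\<^esub> (if m then reflection_class else \<one>\<^bsub>H1\<^esub>)"
proof -
  obtain i p n where st: "st = (i, p, n)" by (metis prod_cases3)
  obtain c where c: "st' = (i, map (perm_of p) c, n)" "(c, m) \<in> set (symmetries i)"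
    using assms(1) unfolding st by (cases st') (auto simp: symmetric.simps)
  have i: "i < 5" and p: "p \<in> arrangements" and w: "w \<in> words X6_vertices"
    using assms(2) by (simp_all add: st tracked_def states_def)
  have aut: "automorphism i c" using i c(2) by (rule symmetry_automorphism)
  then have ca: "c \<in> arrangements" by (simp add: automorphism_def)
  have \<pi>: "perm_of p permutes X6_vertices" and \<gamma>: "perm_of c permutes X6_vertices"
    using p ca by (simp_all add: perm_of_permutes)
  let ?b = "base i" and ?B = "inverse_word (base i)" and ?C = "inv_into UNIV (perm_of c)"
    and ?P = "inv_into UNIV (perm_of p)"
  have C: "?C permutes X6_vertices" and P: "?P permutes X6_vertices"
    using \<pi> \<gamma> by (simp_all add: permutes_inv)
  have bw: "?b \<in> words X6_vertices" "?B \<in> words X6_vertices"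
    using i by (simp_all add: base_words inverse_word_in_words)
  have inv: "inverse_word (?B @ Perm (perm_of c) # ?b) = ?B @ Perm ?C # ?b"
    using inverse_word_inverse_word[OF bw(1)] by (simp add: inverse_word_def)
  have l1: "?B @ Perm ?C # ?b \<in> loops"
    using inverse_word_loop[OF symmetry_loop[OF aut]] unfolding inv .
  have l2: "inverse_word (Perm (perm_of p) # ?b) @ w \<in> loops"
    using assms(2) unfolding st by (rule tracked_loop)
  have "word_equiv X6_vertices X6 ((?B @ [Perm ?C]) @ (?b @ ?B) @ (Perm ?P # w)) ((?B @ [Perm ?C]) @ [] @ (Perm ?P # w))"
    using bw C P w words_Cons[of "Perm ?P" w X6_vertices]
    by (intro word_equiv_context word_equiv_inverse') simp_all
  also have "word_equiv X6_vertices X6 ((?B @ [Perm ?C]) @ [] @ (Perm ?P # w)) (?B @ [Perm (?C \<circ> ?P)] @ w)"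
    using word_equiv_context[OF word_equiv_Perm_comp[OF C P] bw(2) w] by simp
  finally have "h1_class ((?B @ [Perm ?C]) @ (?b @ ?B) @ (Perm ?P # w)) = h1_class (?B @ [Perm (?C \<circ> ?P)] @ w)"
    using mutation_loops_append[OF l1 l2] by (intro h1_class_cong) simp_all
  moreover have "?C \<circ> ?P = inv_into UNIV (perm_of p \<circ> perm_of c)"
    by (simp add: o_inv_distrib permutes_bij[OF \<pi>] permutes_bij[OF \<gamma>])
  ultimately have "h1_class (inverse_word (Perm (perm_of (map (perm_of p) c)) # ?b) @ w) =
      h1_class (?B @ Perm ?C # ?b) \<otimes>\<^bsub>H1\<^esub> h1_class (inverse_word (Perm (perm_of p) # ?b) @ w)"
    using h1_class_append[OF l1 l2] by (simp add: perm_of_map[OF ca \<pi>])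
  moreover have "h1_class (?B @ Perm ?C # ?b) = (if m then reflection_class else \<one>\<^bsub>H1\<^esub>)"
    using h1_class_inverse[OF symmetry_loop[OF aut]] symmetry_class_eq[OF i c(2)]
    unfolding inv by (simp add: symmetry_class_def[symmetric])
  ultimately show ?thesis
    unfolding c(1) st holonomy.simps using l2 by (simp add: H1.m_ac)
qed

section \<open>All defects vanish\<close>

lemma defect_tree:
  assumes "i < 5" "j < 5" "edge i k = start j" "base j = Mut k # base i"
  shows "defect i k = \<one>\<^bsub>H1\<^esub>"
  using holonomy_base[OF assms(2)] by (simp add: defect_def assms(3) flip: assms(4))

text \<open>
  This edge closes up to \<open>\<alpha>\<^sub>1\<close> itself and has weight \<open>1\<close>.
\<close>

lemma defect_0_2: "defect 0 2 = \<one>\<^bsub>H1\<^esub>"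
proof -
  have e: "edge 0 2 = (0, [1, 3, 2, 4, 5, 6], 1)" by (simp add: edge_def edge_table_def)
  have t: "perm_of [1, 3, 2, 4, 5, 6] = transpose 2 3"
  proof
    fix k :: nat
    have "k \<in> {1, 2, 3, 4, 5, 6}" if "1 \<le> k" "k \<le> 6"
      using that unfolding interval_1_6[symmetric] by simp
    then show "perm_of [1, 3, 2, 4, 5, 6] k = transpose 2 3 k"
      by (auto simp: perm_of_def transpose_def)
  qed
  have "inverse_word (Perm (transpose 2 3) # base 0) @ (Mut 2 # base 0) = alpha1_word"
    by (simp add: base_def alpha1_word_def)
  then have "defect 0 2 = h1_class alpha1_word \<otimes>\<^bsub>H1\<^esub> h1_class alpha1_word [^]\<^bsub>H1\<^esub> (- 1 :: int)"
    by (simp only: defect_def e holonomy.simps t)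
  then show ?thesis
    by (simp add: H1.int_pow_neg alpha1_loop)
qed

text \<open>
  The holonomy of \<open>\<mu>\<^sub>k\<close> with respect to the reflected starting state is computed in two ways: as the
  edge at the reflected vertex, and by the change of the state at the end of the edge. Both times the
  reflection contributes the same factor.
\<close>

lemma defect_reflection:
  assumes "i < 5" "k \<in> X6_vertices"
  shows "defect i (position reflection k) = defect i k"
proof -
  let ?st = "(i, reflection, 0) :: state"
  have r: "symmetric True (start i) ?st"
    by (force simp: start_def symmetric.simps symmetries.simps)
  have t: "tracked (base i) (start i)" using assms(1) by (rule tracked_base)
  have t': "tracked (base i) ?st"
    using t reflection_automorphism[OF assms(1)] assms(1)
    by (simp add: tracked_def states_def apply_base automorphism_def)
  have k: "position reflection k \<in> X6_vertices" using perm_of_position(1) assms(2) by simp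
  have tk: "tracked (Mut k # base i) (step (Mut k) (start i))"
    using tracked_step[OF t] assms(2) by simp
  have rk: "symmetric True (step (Mut k) (start i)) (step (Mut k) ?st)"
    using r assms t by (intro symmetric_step) (simp_all add: tracked_def)
  have "holonomy (base i) ?st = reflection_class"
    using holonomy_symmetric[OF r t] holonomy_base[OF assms(1)] by (simp del: holonomy.simps)
  then have "holonomy (Mut k # base i) (step (Mut k) ?st) = defect i (position reflection k) \<otimes>\<^bsub>H1\<^esub> reflection_class"
    using holonomy_Mut[OF t' assms(2)] by (simp del: step.simps holonomy.simps)
  moreover have "holonomy (Mut k # base i) (step (Mut k) (start i)) = defect i k"
  proof -
    have "position ident k = k" using position_eq_iff[of ident k k] assms(2) by simp
    then show ?thesis
      using holonomy_Mut[OF t[unfolded start_def] assms(2)] holonomy_base[OF assms(1)] assms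
      unfolding start_def by (simp del: step.simps holonomy.simps)
  qed
  ultimately show ?thesis
    using holonomy_symmetric[OF rk tk] assms k by (simp del: step.simps holonomy.simps)
qed

lemma symmetric_state_matrix:
  assumes "symmetric m st st'" "st \<in> states"
  shows "state_matrix st' = state_matrix st"
proof -
  obtain i p n c where *: "st = translate (perm_of p) n (start i)" "st' = translate (perm_of p) n (i, c, 0)"
    "i < 5" "p \<in> arrangements" "(c, m) \<in> set (symmetries i)"
    using symmetricE[OF assms] .
  have c: "automorphism i c" using *(3,5) by (rule symmetry_automorphism)
  have "(i, c, 0) \<in> states" using *(3) c by (simp add: states_def automorphism_def)
  then show ?thesis
    using c unfolding *(1,2)
    by (simp add: state_matrix_translate perm_of_permutes[OF *(4)] start_in_states[OF *(3)] automorphism_def)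
qed

text \<open>
  Both sides of a relation give equivalent words, hence the same holonomy with respect to one state;
  and the states to which they lead differ by a symmetry of trivial class.
\<close>

lemma defects_relation:
  assumes "elementary_relation X6_vertices (quiver i) x y" "i < 5"
    "x \<in> words X6_vertices" "y \<in> words X6_vertices"
  shows "defects (trace x (start i)) = defects (trace y (start i))"
proof -
  have t: "tracked (base i) (start i)" using assms(2) by (rule tracked_base)
  have st: "start i \<in> states" using assms(2) by (rule start_in_states)
  have rel: "symmetric False (run x (start i)) (run y (start i))"
    using assms(1) st by (intro run_elementary_relation) simp_all
  have tx: "tracked (x @ base i) (run x (start i))" and ty: "tracked (y @ base i) (run y (start i))"
    using t assms(3,4) by (auto intro: tracked_run)
  have hol: "holonomy (z @ base i) (run z (start i)) = defects (trace z (start i))" if "z \<in> words X6_vertices" for z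
    using holonomy_run[OF t that] holonomy_base[OF assms(2)] defects_closed[OF trace_edges[OF that st]] by simp
  have same: "state_matrix (run x (start i)) = state_matrix (run y (start i))"
    using symmetric_state_matrix[OF rel] assms(3) st by (simp add: run_in_states)
  then have "word_equiv X6_vertices (apply_word (base i) X6) x y"
    using assms state_matrix_run[OF assms(3) st] state_matrix_run[OF assms(4) st]
    by (intro word_equiv_relation) (simp_all add: apply_base)
  from word_equiv_context[OF this, of "[]"] assms(2)
  have "word_equiv X6_vertices X6 (x @ base i) (y @ base i)" by (simp add: base_words)
  then have "holonomy (x @ base i) (run x (start i)) = holonomy (y @ base i) (run x (start i))"
    using tx by (rule holonomy_cong)
  moreover have "tracked (y @ base i) (run x (start i))"
    using tx ty by (simp add: tracked_def same)
  ultimately show ?thesis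
    using holonomy_symmetric[OF rel, of "y @ base i"] hol assms(3,4)
    by (simp add: holonomy_closed)
qed

lemma defects_involution:
  assumes "i < 5" "k \<in> X6_vertices"
  shows "defects (trace [Mut k, Mut k] (start i)) = \<one>\<^bsub>H1\<^esub>"
  using defects_relation[OF elementary_relation.involution, of k i] assms
    words_Cons[of "Mut k" "[Mut k]" X6_vertices] by simp

lemma defects_square:
  assumes "i < 5" "k \<in> X6_vertices" "l \<in> X6_vertices" "quiver i k l = 0"
  shows "defects (trace [Mut k, Mut l] (start i)) = defects (trace [Mut l, Mut k] (start i))"
  using assms words_Cons[of "Mut k" "[Mut l]" X6_vertices] words_Cons[of "Mut l" "[Mut k]" X6_vertices]
  by (intro defects_relation elementary_relation.square) simp_all

lemma defects_pentagon:
  assumes "i < 5" "k \<in> X6_vertices" "l \<in> X6_vertices" "quiver i k l = 1 \<or> quiver i k l = - 1"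
  shows "defects (trace [Mut k, Mut l, Mut k, Mut l, Mut k] (start i)) = \<one>\<^bsub>H1\<^esub>"
proof -
  have "[Mut k, Mut l, Mut k, Mut l, Mut k] \<in> words X6_vertices"
    using assms by (simp add: words_def)
  moreover have "[Perm (transpose k l)] \<in> words X6_vertices"
    using assms by (simp add: permutes_swap_id)
  ultimately have "defects (trace [Mut k, Mut l, Mut k, Mut l, Mut k] (start i)) =
      defects (trace [Perm (transpose k l)] (start i))"
    using assms by (intro defects_relation elementary_relation.pentagon)
  then show ?thesis by simp
qed

text \<open>
  The relations are used in an order in which each of them contains a single edge whose defect is not
  yet known, except for the last two pentagons. With \<open>x\<close> and \<open>y\<close> the defects of the edges at \<open>2\<close> of
  \<open>Q\<^sub>1\<close> and of \<open>Q\<^sub>3\<close>, these say \<open>x y = 1\<close> and \<open>x y\<^sup>2 = 1\<close>.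
\<close>

lemma defect_eq_one:
  assumes "i < 5" "k \<in> X6_vertices"
  shows "defect i k = \<one>\<^bsub>H1\<^esub>"
proof -
  note One_nat_def [simp del]
  have V: "1 \<in> X6_vertices" "2 \<in> X6_vertices" "3 \<in> X6_vertices" "4 \<in> X6_vertices" "5 \<in> X6_vertices" "6 \<in> X6_vertices"
    by (simp_all add: X6_vertices_def)
  have closed [simp]: "defect i k \<in> carrier H1" if "i < 5" "1 \<le> k" "k \<le> 6" for i k
    using that by (simp add: X6_vertices_def)
  have tree [simp]: "defect 0 1 = \<one>\<^bsub>H1\<^esub>" "defect 0 6 = \<one>\<^bsub>H1\<^esub>" "defect 2 1 = \<one>\<^bsub>H1\<^esub>" "defect 1 6 = \<one>\<^bsub>H1\<^esub>"
    using defect_tree[of 0 1 1] defect_tree[of 0 2 6] defect_tree[of 2 3 1] defect_tree[of 1 4 6]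
    by (simp_all add: edge_def edge_table_def start_def ident_def base_def)
  note [simp] = defect_0_2
  have "trace [Mut 1, Mut 1] (start 0) = [(1, 1), (0, 1)]" "trace [Mut 2, Mut 2] (start 0) = [(0, 3), (0, 2)]"
    "trace [Mut 6, Mut 6] (start 0) = [(2, 6), (0, 6)]" "trace [Mut 6, Mut 6] (start 1) = [(4, 6), (1, 6)]"
    "trace [Mut 1, Mut 1] (start 2) = [(3, 1), (2, 1)]"
    by code_simp+
  then have [simp]: "defect 1 1 = \<one>\<^bsub>H1\<^esub>" "defect 0 3 = \<one>\<^bsub>H1\<^esub>" "defect 2 6 = \<one>\<^bsub>H1\<^esub>" "defect 4 6 = \<one>\<^bsub>H1\<^esub>" "defect 3 1 = \<one>\<^bsub>H1\<^esub>"
    using defects_involution[of 0 1] defects_involution[of 0 2] defects_involution[of 0 6]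
      defects_involution[of 1 6] defects_involution[of 2 1] V by (simp_all del: trace.simps)
  have "trace [Mut 6, Mut 2] (start 0) = [(0, 6), (0, 2)]" "trace [Mut 2, Mut 6] (start 0) = [(2, 2), (0, 6)]"
    "quiver 0 6 2 = 0"
    by code_simp+
  then have [simp]: "defect 2 2 = \<one>\<^bsub>H1\<^esub>"
    using defects_square[of 0 6 2] V by (simp del: trace.simps)
  have "trace [Mut 2, Mut 2] (start 2) = [(2, 3), (2, 2)]" by code_simp
  then have [simp]: "defect 2 3 = \<one>\<^bsub>H1\<^esub>"
    using defects_involution[of 2 2] V by (simp del: trace.simps)
  have "trace [Mut 1, Mut 6, Mut 1, Mut 6, Mut 1] (start 3) = [(4, 1), (1, 6), (0, 1), (2, 6), (3, 1)]"
    "quiver 3 1 6 = 1"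
    by code_simp+
  then have [simp]: "defect 4 1 = \<one>\<^bsub>H1\<^esub>"
    using defects_pentagon[of 3 1 6] V by (simp del: trace.simps)
  have "trace [Mut 1, Mut 1] (start 4) = [(3, 6), (4, 1)]" by code_simp
  then have [simp]: "defect 3 6 = \<one>\<^bsub>H1\<^esub>"
    using defects_involution[of 4 1] V by (simp del: trace.simps)
  have "trace [Mut 6, Mut 6] (start 3) = [(4, 5), (3, 6)]" by code_simp
  then have [simp]: "defect 4 5 = \<one>\<^bsub>H1\<^esub>"
    using defects_involution[of 3 6] V by (simp del: trace.simps)
  have "trace [Mut 1, Mut 6, Mut 1, Mut 6, Mut 1] (start 1) = [(4, 2), (3, 6), (2, 1), (0, 6), (1, 1)]"
    "quiver 1 1 6 = - 1"
    by code_simp+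
  then have [simp]: "defect 4 2 = \<one>\<^bsub>H1\<^esub>"
    using defects_pentagon[of 1 1 6] V by (simp del: trace.simps)
  have "position reflection 2 = 4" "position reflection 3 = 5" "position reflection 5 = 3"
    by code_simp+
  then have flip: "defect i 4 = defect i 2" "defect i 5 = defect i 3" if "i < 5" for i
    using defect_reflection[OF that, of 2] defect_reflection[OF that, of 3] V by simp_all
  have "trace [Mut 2, Mut 3, Mut 2, Mut 3, Mut 2] (start 1) = [(3, 2), (2, 1), (2, 3), (3, 1), (1, 2)]"
    "trace [Mut 2, Mut 5, Mut 2, Mut 5, Mut 2] (start 1) = [(3, 4), (4, 5), (1, 6), (3, 4), (1, 2)]"
    "quiver 1 2 3 = 1" "quiver 1 2 5 = - 1"
    by code_simp+
  then have "defect 3 2 \<otimes>\<^bsub>H1\<^esub> defect 1 2 = \<one>\<^bsub>H1\<^esub>"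
    "defect 3 2 \<otimes>\<^bsub>H1\<^esub> (defect 3 2 \<otimes>\<^bsub>H1\<^esub> defect 1 2) = \<one>\<^bsub>H1\<^esub>"
    using defects_pentagon[of 1 2 3] defects_pentagon[of 1 2 5] V by (simp_all add: flip(1) del: trace.simps)
  then have [simp]: "defect 3 2 = \<one>\<^bsub>H1\<^esub>" "defect 1 2 = \<one>\<^bsub>H1\<^esub>" by simp_all
  have "trace [Mut 2, Mut 2] (start 1) = [(3, 3), (1, 2)]" "trace [Mut 3, Mut 3] (start 1) = [(3, 2), (1, 3)]"
    by code_simp+
  then have [simp]: "defect 3 3 = \<one>\<^bsub>H1\<^esub>" "defect 1 3 = \<one>\<^bsub>H1\<^esub>"
    using defects_involution[of 1 2] defects_involution[of 1 3] V by (simp_all del: trace.simps)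
  have "defect 4 3 = \<one>\<^bsub>H1\<^esub>" using flip(2)[of 4] by simp
  then have "\<forall>i\<in>{0, 1, 2, 3, 4}. \<forall>k\<in>{1, 2, 3, 4, 5, 6}. defect i k = \<one>\<^bsub>H1\<^esub>"
    by (simp add: flip)
  moreover have "i \<in> {0, 1, 2, 3, 4}" using assms(1) by auto
  moreover have "k \<in> {1, 2, 3, 4, 5, 6}"
    using assms(2) unfolding X6_vertices_def interval_1_6 .
  ultimately show ?thesis by blast
qed

lemma h1_class_eq_winding:
  assumes "w \<in> loops"
  shows "h1_class w = h1_class alpha1_word [^]\<^bsub>H1\<^esub> fst (winding w) \<otimes>\<^bsub>H1\<^esub> reflection_class [^]\<^bsub>H1\<^esub> snd (winding w)"
proof -
  obtain p n where r: "run w (start 0) = (0, p, n)" "p = ident \<or> p = reflection"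
    using loop_state[OF assms] .
  have w: "w \<in> words X6_vertices" "apply_word w X6 = X6" using assms by (simp_all add: mutation_loops_def)
  have one: "defects es = \<one>\<^bsub>H1\<^esub>" if "set es \<subseteq> {..<5} \<times> X6_vertices" for es
    using that by (induction es rule: defects.induct) (auto simp: defect_eq_one)
  have b: "base 0 = []" by (simp add: base_def)
  have "holonomy (w @ base 0) (run w (start 0)) = \<one>\<^bsub>H1\<^esub>"
    using holonomy_run[OF tracked_base w(1), of 0] one[OF trace_edges[OF w(1) start_in_states]]
    by (simp add: holonomy_base)
  then have hol: "holonomy w (0, p, n) = \<one>\<^bsub>H1\<^esub>" by (simp add: b r(1) del: holonomy.simps)
  have t: "tracked w (0, ident, n)"
    using w by (simp add: tracked_def states_def quiver_0)
  have "symmetric (p \<noteq> ident) (0, ident, n) (0, p, n)"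
    using r(2) by (auto simp: symmetric_0)
  \<comment> \<open>Passing from the identity arrangement to the reflection accounts for the second component.\<close>
  from holonomy_symmetric[OF this t] hol
  have "holonomy w (0, ident, n) \<otimes>\<^bsub>H1\<^esub> (if p \<noteq> ident then reflection_class else \<one>\<^bsub>H1\<^esub>) = \<one>\<^bsub>H1\<^esub>" by simp
  moreover have "holonomy w (0, ident, n) = h1_class w \<otimes>\<^bsub>H1\<^esub> h1_class alpha1_word [^]\<^bsub>H1\<^esub> (- n)"
  proof -
    have "word_equiv X6_vertices X6 ([Perm id] @ w) ([] @ w)"
      using word_equiv_context[OF word_equiv_Perm_id words_Nil w(1)] by simp
    moreover have "[Perm id] @ w \<in> loops"
      using tracked_loop[OF t] by (simp add: b)
    ultimately have "h1_class ([Perm id] @ w) = h1_class w" using h1_class_cong by fastforce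
    then show ?thesis by (simp add: b)
  qed
  ultimately have "h1_class w \<otimes>\<^bsub>H1\<^esub> h1_class alpha1_word [^]\<^bsub>H1\<^esub> (- n) \<otimes>\<^bsub>H1\<^esub> (if p \<noteq> ident then reflection_class else \<one>\<^bsub>H1\<^esub>) = \<one>\<^bsub>H1\<^esub>" by simp
  moreover define X where "X = (if p \<noteq> ident then reflection_class else \<one>\<^bsub>H1\<^esub>)"
  ultimately have *: "h1_class w \<otimes>\<^bsub>H1\<^esub> h1_class alpha1_word [^]\<^bsub>H1\<^esub> (- n) \<otimes>\<^bsub>H1\<^esub> X = \<one>\<^bsub>H1\<^esub>" by simp
  have X: "X \<in> carrier H1" "X \<otimes>\<^bsub>H1\<^esub> X = \<one>\<^bsub>H1\<^esub>" by (simp_all add: X_def)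
  have A: "h1_class alpha1_word [^]\<^bsub>H1\<^esub> (- n) \<otimes>\<^bsub>H1\<^esub> h1_class alpha1_word [^]\<^bsub>H1\<^esub> n = \<one>\<^bsub>H1\<^esub>"
    using H1.int_pow_mult[of "h1_class alpha1_word" "- n" n] by (simp add: alpha1_loop)
  have "h1_class w = h1_class w \<otimes>\<^bsub>H1\<^esub> (h1_class alpha1_word [^]\<^bsub>H1\<^esub> (- n) \<otimes>\<^bsub>H1\<^esub> h1_class alpha1_word [^]\<^bsub>H1\<^esub> n) \<otimes>\<^bsub>H1\<^esub> (X \<otimes>\<^bsub>H1\<^esub> X)"
    using assms by (simp add: A X(2))
  also have "\<dots> = h1_class w \<otimes>\<^bsub>H1\<^esub> h1_class alpha1_word [^]\<^bsub>H1\<^esub> (- n) \<otimes>\<^bsub>H1\<^esub> X \<otimes>\<^bsub>H1\<^esub> (h1_class alpha1_word [^]\<^bsub>H1\<^esub> n \<otimes>\<^bsub>H1\<^esub> X)"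
    using assms X(1) by (simp add: H1.m_ac del: H1.int_pow_neg)
  also have "\<dots> = h1_class alpha1_word [^]\<^bsub>H1\<^esub> n \<otimes>\<^bsub>H1\<^esub> X"
    using X(1) by (simp add: *)
  finally have "h1_class w = h1_class alpha1_word [^]\<^bsub>H1\<^esub> n \<otimes>\<^bsub>H1\<^esub> (if p \<noteq> ident then reflection_class else \<one>\<^bsub>H1\<^esub>)"
    by (simp add: X_def)
  then show ?thesis
    by (auto simp: winding_def r(1))
qed

section \<open>The isomorphism\<close>

abbreviation target :: "(int \<times> int) monoid" where
  "target \<equiv> integer_group \<times>\<times> integer_mod_group 2"

lemma comm_group_target: "comm_group target"
proof -
  have "group target" by (intro DirProd_group) simp_all
  then show ?thesis
    by (rule group.group_comm_groupI) (auto simp: add.commute)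
qed

definition class_winding :: "nat word set \<Rightarrow> int \<times> int" where
  "class_winding X = winding (SOME w. w \<in> loops \<and> loop_class X6_vertices X6 w = X)"

lemma class_winding_loop_class:
  assumes "w \<in> loops"
  shows "class_winding (loop_class X6_vertices X6 w) = winding w"
proof -
  let ?v = "SOME v. v \<in> loops \<and> loop_class X6_vertices X6 v = loop_class X6_vertices X6 w"
  have "?v \<in> loops \<and> loop_class X6_vertices X6 ?v = loop_class X6_vertices X6 w"
    by (rule someI[of _ w]) (simp add: assms)
  then have "(?v, w) \<in> loop_equiv X6_vertices X6"
    using assms loop_class_eq_iff by blast
  then show ?thesis unfolding class_winding_def by (rule winding_loop_equiv)
qed

lemma carrier_Gamma_X6: "carrier Gamma_X6 = loop_class X6_vertices X6 ` loops"
  by (simp add: Gamma_X6_def carrier_saturated_modular_group)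

lemma snd_winding: "snd (winding w) \<in> {0, 1}"
  by (simp add: winding_def split: prod.split)

lemma class_winding_hom: "class_winding \<in> hom Gamma_X6 target"
proof (rule homI)
  fix x y assume "x \<in> carrier Gamma_X6" "y \<in> carrier Gamma_X6"
  then obtain u v where "u \<in> loops" "v \<in> loops"
    "x = loop_class X6_vertices X6 u" "y = loop_class X6_vertices X6 v"
    by (auto simp: carrier_Gamma_X6)
  then show "class_winding (x \<otimes>\<^bsub>Gamma_X6\<^esub> y) = class_winding x \<otimes>\<^bsub>target\<^esub> class_winding y"
    by (simp add: Gamma_X6_def mult_loop_class class_winding_loop_class mutation_loops_append
        winding_append DirProd_def split: prod.split)
next
  fix x assume "x \<in> carrier Gamma_X6"
  then obtain u where "u \<in> loops" "x = loop_class X6_vertices X6 u"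
    by (auto simp: carrier_Gamma_X6)
  then show "class_winding x \<in> carrier target"
    using snd_winding[of u]
    by (auto simp: class_winding_loop_class carrier_integer_mod_group mem_Times_iff)
qed

lemma winding_generators: "winding alpha1_word = (1, 0)" "winding beta1_word = (1, 1)"
  by code_simp+

lemma class_winding_generators: "class_winding alpha1 = (1, 0)" "class_winding beta1 = (1, 1)"
  by (simp_all add: alpha1_def beta1_def class_winding_loop_class alpha1_loop beta1_loop winding_generators)

interpretation winding_hom: group_hom Gamma_X6 target class_winding
  using group_Gamma_X6 comm_group_target class_winding_hom
  by (simp add: group_hom_def group_hom_axioms_def comm_group.axioms(2))

lemma class_winding_surj: "class_winding ` carrier Gamma_X6 = carrier target"
proof
  show "class_winding ` carrier Gamma_X6 \<subseteq> carrier target"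
    using winding_hom.hom_closed by blast
  have pow: "class_winding (alpha1 [^]\<^bsub>Gamma_X6\<^esub> n) = (n, 0)" for n :: int
  proof -
    have "fst \<circ> class_winding \<in> hom Gamma_X6 integer_group"
      using class_winding_hom by (rule Group.hom_compose) (auto simp: hom_def)
    from hom_int_pow[OF this alpha1_carrier group_Gamma_X6, of n]
    have 1: "fst (class_winding (alpha1 [^]\<^bsub>Gamma_X6\<^esub> n)) = n" by (simp add: class_winding_generators)
    have "snd \<circ> class_winding \<in> hom Gamma_X6 (integer_mod_group 2)"
      using class_winding_hom by (rule Group.hom_compose) (auto simp: hom_def)
    from hom_int_pow[OF this alpha1_carrier group_Gamma_X6, of n]
    have "snd (class_winding (alpha1 [^]\<^bsub>Gamma_X6\<^esub> n)) = \<one>\<^bsub>integer_mod_group 2\<^esub> [^]\<^bsub>integer_mod_group 2\<^esub> n"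
      by (simp add: class_winding_generators)
    then have 2: "snd (class_winding (alpha1 [^]\<^bsub>Gamma_X6\<^esub> n)) = 0"
      using group.int_pow_one[of "integer_mod_group 2"] by simp
    show ?thesis using 1 2 by (simp add: prod_eq_iff)
  qed
  show "carrier target \<subseteq> class_winding ` carrier Gamma_X6"
  proof
    fix x assume "x \<in> carrier target"
    then obtain n m where nm: "x = (n, m)" "0 \<le> m" "m < 2"
      by (cases x) (auto simp: carrier_integer_mod_group)
    then have x: "x = (n, m)" "m = 0 \<or> m = 1" by auto
    have a: "alpha1 [^]\<^bsub>Gamma_X6\<^esub> k \<in> carrier Gamma_X6" for k :: int
      using group.int_pow_closed[OF group_Gamma_X6 alpha1_carrier] .
    \<comment> \<open>The winding of \<open>\<beta>\<^sub>1\<close> already contributes \<open>1\<close> to the first component.\<close>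
    have "class_winding (alpha1 [^]\<^bsub>Gamma_X6\<^esub> (n - 1) \<otimes>\<^bsub>Gamma_X6\<^esub> beta1) = (n, 1)"
      by (simp add: winding_hom.hom_mult[OF a beta1_carrier] pow class_winding_generators)
    moreover have "alpha1 [^]\<^bsub>Gamma_X6\<^esub> (n - 1) \<otimes>\<^bsub>Gamma_X6\<^esub> beta1 \<in> carrier Gamma_X6"
      using a beta1_carrier by simp
    ultimately show "x \<in> class_winding ` carrier Gamma_X6"
      using x a pow by (metis image_eqI)
  qed
qed

text \<open>
  The target is commutative, which gives one inclusion; the other one holds because the winding
  determines the class in homology.
\<close>

lemma kernel_class_winding: "kernel Gamma_X6 target class_winding = derived Gamma_X6 (carrier Gamma_X6)"
proof
  interpret T: comm_group target by (rule comm_group_target)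
  let ?D = "derived Gamma_X6 (carrier Gamma_X6)"
  have D: "?D \<subseteq> carrier Gamma_X6" by (rule group.derived_in_carrier[OF group_Gamma_X6]) simp
  have "class_winding ` ?D = derived target (class_winding ` carrier Gamma_X6)"
    using winding_hom.derived_img[of "carrier Gamma_X6"] by simp
  also have "\<dots> = {\<one>\<^bsub>target\<^esub>}" 
    by (rule T.derived_eq_singleton) (use winding_hom.hom_closed in blast)
  finally show "?D \<subseteq> kernel Gamma_X6 target class_winding"
    using D unfolding kernel_def by blast
  show "kernel Gamma_X6 target class_winding \<subseteq> ?D"
  proof
    fix x assume "x \<in> kernel Gamma_X6 target class_winding"
    then have x: "x \<in> carrier Gamma_X6" and one: "class_winding x = (0, 0)" by (auto simp: kernel_def)
    obtain w where w: "w \<in> loops" "x = loop_class X6_vertices X6 w" using x by (auto simp: carrier_Gamma_X6)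
    have "winding w = (0, 0)" using one w by (simp add: class_winding_loop_class)
    then have "ab_class Gamma_X6 x = \<one>\<^bsub>H1\<^esub>"
      using h1_class_eq_winding[OF w(1)] w by (simp add: h1_class_def)
    then have "?D #>\<^bsub>Gamma_X6\<^esub> x = ?D" by (simp add: ab_class_def abelianization_def)
    then show "x \<in> ?D"
      using group.rcos_self[OF group_Gamma_X6 x group.derived_is_subgroup[OF group_Gamma_X6, of "carrier Gamma_X6"]] by simp
  qed
qed

theorem corollary1p5:
  shows "abelianization Gamma_X6 \<cong> integer_group \<times>\<times> integer_mod_group 2 \<and>
    generate (abelianization Gamma_X6) {ab_class Gamma_X6 alpha1, ab_class Gamma_X6 beta1}
      = carrier (abelianization Gamma_X6)"
proof
  show "abelianization Gamma_X6 \<cong> integer_group \<times>\<times> integer_mod_group 2"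
    using winding_hom.FactGroup_iso[OF class_winding_surj]
    by (simp add: abelianization_def kernel_class_winding)
  let ?A = "h1_class alpha1_word" and ?B = "h1_class beta1_word"
  have AB: "ab_class Gamma_X6 alpha1 = ?A" "ab_class Gamma_X6 beta1 = ?B"
    by (simp_all add: h1_class_def alpha1_def beta1_def)
  have gens: "{?A, ?B} \<subseteq> carrier H1" by (simp add: alpha1_loop beta1_loop)
  let ?N = "generate H1 {?A, ?B}"
  have N: "subgroup ?N H1" using gens by (rule H1.generate_is_subgroup)
  have A: "?A \<in> ?N" and B: "?B \<in> ?N" by (auto intro: generate.incl)
  have "?B = ?A \<otimes>\<^bsub>H1\<^esub> reflection_class"
    using h1_class_eq_winding[OF beta1_loop] by (simp add: winding_generators alpha1_loop)
  then have "reflection_class = inv\<^bsub>H1\<^esub> ?A \<otimes>\<^bsub>H1\<^esub> ?B"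
    by (simp add: alpha1_loop flip: H1.m_assoc)
  then have S: "reflection_class \<in> ?N"
    using subgroup.m_closed[OF N subgroup.m_inv_closed[OF N A] B] by simp
  have "carrier H1 \<subseteq> ?N"
  proof
    fix X assume "X \<in> carrier H1"
    then obtain x where "x \<in> carrier Gamma_X6" "X = ab_class Gamma_X6 x"
      by (auto simp: abelianization_def carrier_FactGroup ab_class_def)
    then obtain w where "w \<in> loops" "X = h1_class w"
      by (auto simp: carrier_Gamma_X6 h1_class_def)
    then have "X = ?A [^]\<^bsub>H1\<^esub> fst (winding w) \<otimes>\<^bsub>H1\<^esub> reflection_class [^]\<^bsub>H1\<^esub> snd (winding w)"
      using h1_class_eq_winding by simp
    then show "X \<in> ?N"
      using N A S by (simp add: subgroup.m_closed H1.subgroup_int_pow_closed)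
  qed
  then show "generate (abelianization Gamma_X6) {ab_class Gamma_X6 alpha1, ab_class Gamma_X6 beta1}
      = carrier (abelianization Gamma_X6)"
    using H1.generate_incl[OF gens] unfolding AB by blast
qed

end
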